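(* Let $L=L_1\cup\cdots\cup L_k$ be a ladder in $X$ and $t=(t_1,\dots,t_k)$ a vector of positive integers. For each $j$ let $X_j$ be the smallest submatrix of $X$ containing $L_j$. Let $X'=X_1\cup\cdots\cup X_k$ and let $I_t(X')=I_{t_1}(X_1)+\cdots+I_{t_k}(X_k)\subseteq K[X']$. Then $$I_t(X')\cap K[L]=I_t(L).$$ In particular, $I_t(L)$ is a prime ideal of $K[L]$.
   Context: $K$ is an algebraically closed field. $X=(x_{b,a})$ is an $m\times n$ matrix of distinct indeterminates over $K$ ($x_{b,a}$ lies in row $b$ and column $a$), with $m\le n$. Ladder: given integers $1=b_1<\cdots<b_h\le m$, $1\le a_1<\cdots<a_h=n$ (the upper outside corners are $(b_i,a_i)$) and $1\le d_1\le\cdots\le d_k=m$, $1=c_1\le\cdots\le c_k\le n$ with the pairs $(d_j,c_j)$ distinct (the lower outside corners), the associated ladder is the set $L$ of all $x_{b,a}$ for which there are $i,j$ with $b_i\le b\le d_j$ and $c_j\le a\le a_i$. Put $L_j=\{x_{b,a}\in L: b\le d_j,\ a\ge c_j\}$, so $L=\bigcup_j L_j$. Explicitly, $X_j=\{x_{b,a}\in X: b_{l_j}\le b\le d_j,\ c_j\le a\le a_{h_j}\}$, where $l_j=\min\{i: x_{b_i,a_i}\in L_j\}$ and $h_j=\max\{i: x_{b_i,a_i}\in L_j\}$. For a set $S$ of entries of $X$, $K[S]$ is the polynomial ring in the elements of $S$. For $s\ge1$ and a subset $S$ of the entries of $X$, $I_s(S)$ is the ideal generated by all $s\times s$ minors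 of $X$ all of whose entries lie in $S$. The mixed ladder determinantal ideal is $I_t(L)=I_{t_1}(L_1)+\cdots+I_{t_k}(L_k)\subset K[L]$. Standing assumptions: every entry of $L$ is an entry of some $t_j\times t_j$ submatrix contained in $L_j$ for some $j$; and $I_{t_i}(L_i)\not\subseteq I_{t_j}(L_j)$ for $i\ne j$, so that $d_{j+1}-d_j>t_{j+1}-t_j$ and $c_{j+1}-c_j>t_j-t_{j+1}$ for $1\le j<k$. *)

theory Defs
  imports
    "HOL-Library.Poly_Mapping"
    "HOL-Computational_Algebra.Polynomial"
    "HOL-Algebra.Ideal"
    "Jordan_Normal_Form.Determinant"
begin

text \<open>
  The indeterminate in row \<open>r\<close> and column \<open>q\<close> is indexed by the pair \<open>(r, q)\<close>, both
  coordinates counted from 1.  All polynomial rings \<open>K[S]\<close> live inside one type, as the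
  polynomials in which only indeterminates of \<open>S\<close> occur.
\<close>

type_synonym 'k mpoly = "((nat \<times> nat) \<Rightarrow>\<^sub>0 nat) \<Rightarrow>\<^sub>0 'k"

definition var :: "nat \<times> nat \<Rightarrow> 'k::comm_ring_1 mpoly" where
  "var v = Poly_Mapping.single (Poly_Mapping.single v 1) 1"

definition polys :: "(nat \<times> nat) set \<Rightarrow> 'k::comm_ring_1 mpoly set" where
  "polys S = {p. \<forall>mon \<in> Poly_Mapping.keys p. Poly_Mapping.keys mon \<subseteq> S}"

definition poly_ring :: "(nat \<times> nat) set \<Rightarrow> 'k::comm_ring_1 mpoly ring" where
  "poly_ring S = \<lparr>carrier = polys S, monoid.mult = (*), one = 1, zero = 0, add = (+)\<rparr>"

text \<open>
  Minors are indexed by their sets \<open>R\<close> of rows and \<open>C\<close> of columns.  For \<open>s \<ge> 1\<close> both sets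
  are finite, and when \<open>S\<close> consists of positions of \<open>X\<close> the inclusion \<open>R \<times> C \<subseteq> S\<close> keeps
  them inside the row and column ranges of \<open>X\<close>.
\<close>

definition minors :: "nat \<Rightarrow> (nat \<times> nat) set \<Rightarrow> 'k::comm_ring_1 mpoly set" where
  "minors s S =
     {det (mat s s (\<lambda>(i, j). var (sorted_list_of_set R ! i, sorted_list_of_set C ! j))) | R C.
        card R = s \<and> card C = s \<and> R \<times> C \<subseteq> S}"

text \<open>\<open>det_ideal U s S\<close> is \<open>I\<^sub>s(S)\<close>, formed in \<open>K[U]\<close> (for \<open>S \<subseteq> U\<close>).\<close>

definition det_ideal ::
    "(nat \<times> nat) set \<Rightarrow> nat \<Rightarrow> (nat \<times> nat) set \<Rightarrow> 'k::comm_ring_1 mpoly set" where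
  "det_ideal U s S = genideal (poly_ring U) (minors s S)"

definition mixed_det_ideal ::
    "nat \<Rightarrow> (nat \<Rightarrow> nat) \<Rightarrow> (nat \<Rightarrow> (nat \<times> nat) set) \<Rightarrow> 'k::comm_ring_1 mpoly set" where
  "mixed_det_ideal k t Y =
     {\<Sum>j=1..k. f j | f. \<forall>j\<in>{1..k}. f j \<in> det_ideal (\<Union>i\<in>{1..k}. Y i) (t j) (Y j)}"

definition ladder_corners ::
    "nat \<Rightarrow> nat \<Rightarrow> nat \<Rightarrow> (nat \<Rightarrow> nat) \<Rightarrow> (nat \<Rightarrow> nat) \<Rightarrow> nat \<Rightarrow> (nat \<Rightarrow> nat) \<Rightarrow> (nat \<Rightarrow> nat) \<Rightarrow> bool"
  where
  "ladder_corners m n h b a k d c \<longleftrightarrow>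
     1 \<le> h \<and> b 1 = 1 \<and> strict_mono_on {1..h} b \<and> b h \<le> m \<and>
     1 \<le> a 1 \<and> strict_mono_on {1..h} a \<and> a h = n \<and>
     1 \<le> k \<and> 1 \<le> d 1 \<and> mono_on {1..k} d \<and> d k = m \<and>
     c 1 = 1 \<and> mono_on {1..k} c \<and> c k \<le> n \<and>
     inj_on (\<lambda>j. (d j, c j)) {1..k}"

definition ladder ::
    "nat \<Rightarrow> (nat \<Rightarrow> nat) \<Rightarrow> (nat \<Rightarrow> nat) \<Rightarrow> nat \<Rightarrow> (nat \<Rightarrow> nat) \<Rightarrow> (nat \<Rightarrow> nat) \<Rightarrow> (nat \<times> nat) set"
  where
  "ladder h b a k d c =
     {(r, q). \<exists>i\<in>{1..h}. \<exists>j\<in>{1..k}. b i \<le> r \<and> r \<le> d j \<and> c j \<le> q \<and> q \<le> a i}"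

definition subladder ::
    "nat \<Rightarrow> (nat \<Rightarrow> nat) \<Rightarrow> (nat \<Rightarrow> nat) \<Rightarrow> nat \<Rightarrow> (nat \<Rightarrow> nat) \<Rightarrow> (nat \<Rightarrow> nat) \<Rightarrow> nat \<Rightarrow> (nat \<times> nat) set"
  where
  "subladder h b a k d c j = {(r, q) \<in> ladder h b a k d c. r \<le> d j \<and> c j \<le> q}"

definition is_submatrix :: "nat \<Rightarrow> nat \<Rightarrow> (nat \<times> nat) set \<Rightarrow> bool" where
  "is_submatrix m n Y \<longleftrightarrow> (\<exists>R C. R \<subseteq> {1..m} \<and> C \<subseteq> {1..n} \<and> Y = R \<times> C)"

text \<open>The least element is taken with respect to inclusion.\<close>

definition smallest_submatrix :: "nat \<Rightarrow> nat \<Rightarrow> (nat \<times> nat) set \<Rightarrow> (nat \<times> nat) set" where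
  "smallest_submatrix m n S = (LEAST Y. is_submatrix m n Y \<and> S \<subseteq> Y)"

lemma smallest_submatrix_eq:
  assumes "S \<subseteq> {1..m} \<times> {1..n}"
  shows "smallest_submatrix m n S = fst ` S \<times> snd ` S"
  unfolding smallest_submatrix_def
proof (rule Least_equality)
  show "is_submatrix m n (fst ` S \<times> snd ` S) \<and> S \<subseteq> fst ` S \<times> snd ` S"
    unfolding is_submatrix_def using assms by (intro conjI exI[of _ "fst ` S"] exI[of _ "snd ` S"]) force+
next
  fix Y assume "is_submatrix m n Y \<and> S \<subseteq> Y"
  then obtain R C where "Y = R \<times> C" "S \<subseteq> R \<times> C" unfolding is_submatrix_def by blast
  then show "fst ` S \<times> snd ` S \<subseteq> Y" by auto
qed

lemma subladder_eq:
  assumes "j \<in> {1..k}"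
  shows "subladder h b a k d c j =
    {(r, q). \<exists>i\<in>{1..h}. b i \<le> r \<and> r \<le> d j \<and> c j \<le> q \<and> q \<le> a i}"
  using assms unfolding subladder_def ladder_def by blast

lemma UN_subladder: "(\<Union>j\<in>{1..k}. subladder h b a k d c j) = ladder h b a k d c"
  unfolding subladder_def ladder_def by blast

lemma ladder_subset:
  assumes L: "ladder_corners m n h b a k d c"
  shows "ladder h b a k d c \<subseteq> {1..m} \<times> {1..n}"
proof -
  have "1 \<le> b i \<and> a i \<le> n" if "i \<in> {1..h}" for i
    using L that strict_mono_on_leD[of "{1..h}" b 1 i] strict_mono_on_leD[of "{1..h}" a i h]
    unfolding ladder_corners_def by auto
  moreover have "d j \<le> m \<and> 1 \<le> c j" if "j \<in> {1..k}" for j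
    using L that mono_onD[of "{1..k}" d j k] mono_onD[of "{1..k}" c 1 j]
    unfolding ladder_corners_def by auto
  ultimately show ?thesis unfolding ladder_def by fastforce
qed

text \<open>The explicit description of the smallest submatrix containing a subladder.\<close>

lemma smallest_submatrix_subladder:
  fixes h k :: nat and b a d c :: "nat \<Rightarrow> nat"
  assumes L: "ladder_corners m n h b a k d c" and j: "j \<in> {1..k}"
    and ne: "subladder h b a k d c j \<noteq> {}"
  defines "I \<equiv> {i \<in> {1..h}. (b i, a i) \<in> subladder h b a k d c j}"
  shows "smallest_submatrix m n (subladder h b a k d c j) =
    {b (Min I)..d j} \<times> {c j..a (Max I)}"
proof -
  let ?L = "subladder h b a k d c j"
  have sub: "?L \<subseteq> {1..m} \<times> {1..n}"
    using ladder_subset[OF L] unfolding subladder_def by blast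
  have mb: "b i \<le> b i'" and ma: "a i \<le> a i'" if "i \<in> {1..h}" "i' \<in> {1..h}" "i \<le> i'" for i i'
    using L that unfolding ladder_corners_def by (auto intro: strict_mono_on_leD)
  have I_eq: "I = {i \<in> {1..h}. b i \<le> d j \<and> c j \<le> a i}"
    unfolding I_def subladder_eq[OF j] by fastforce
  have fin: "finite I" unfolding I_def by simp
  have "I \<noteq> {}" using ne unfolding I_eq subladder_eq[OF j] by fastforce
  then have m1: "Min I \<in> I" and m2: "Max I \<in> I" using fin by auto
  have mem: "r \<in> fst ` ?L \<longleftrightarrow> (\<exists>i\<in>I. b i \<le> r \<and> r \<le> d j)" for r
  proof
    assume "r \<in> fst ` ?L"
    then show "\<exists>i\<in>I. b i \<le> r \<and> r \<le> d j" unfolding subladder_eq[OF j] I_eq by fastforce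
  next
    assume "\<exists>i\<in>I. b i \<le> r \<and> r \<le> d j"
    then obtain i where "i \<in> I" "b i \<le> r" "r \<le> d j" by blast
    then have "(r, a i) \<in> ?L" unfolding subladder_eq[OF j] I_eq by auto
    then show "r \<in> fst ` ?L" by force
  qed
  have mem': "q \<in> snd ` ?L \<longleftrightarrow> (\<exists>i\<in>I. c j \<le> q \<and> q \<le> a i)" for q
  proof
    assume "q \<in> snd ` ?L"
    then show "\<exists>i\<in>I. c j \<le> q \<and> q \<le> a i" unfolding subladder_eq[OF j] I_eq by fastforce
  next
    assume "\<exists>i\<in>I. c j \<le> q \<and> q \<le> a i"
    then obtain i where "i \<in> I" "c j \<le> q" "q \<le> a i" by blast
    then have "(b i, q) \<in> ?L" unfolding subladder_eq[OF j] I_eq by auto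
    then show "q \<in> snd ` ?L" by force
  qed
  have I_sub: "i \<in> I \<Longrightarrow> i \<in> {1..h}" for i unfolding I_eq by blast
  have "b (Min I) \<le> b i" and "a i \<le> a (Max I)" if "i \<in> I" for i
    using mb[of "Min I" i] ma[of i "Max I"] that m1 m2 fin I_sub by auto
  then have "fst ` ?L = {b (Min I)..d j}" and "snd ` ?L = {c j..a (Max I)}"
    using m1 m2 by (auto simp: mem mem' set_eq_iff intro: order_trans)
  then show ?thesis using smallest_submatrix_eq[OF sub] by simp
qed

lemma polys_closed:
  "0 \<in> polys S" "1 \<in> polys S"
  "p \<in> polys S \<Longrightarrow> q \<in> polys S \<Longrightarrow> p + q \<in> polys S"
  "p \<in> polys S \<Longrightarrow> q \<in> polys S \<Longrightarrow> p * q \<in> polys S"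
  "p \<in> polys S \<Longrightarrow> - p \<in> polys S"
  "v \<in> S \<Longrightarrow> var v \<in> polys S"
proof -
  show "p + q \<in> polys S" if "p \<in> polys S" "q \<in> polys S"
    using that Poly_Mapping.keys_add[of p q] unfolding polys_def by blast
  show "p * q \<in> polys S" if p: "p \<in> polys S" and q: "q \<in> polys S"
    unfolding polys_def
  proof (intro CollectI ballI)
    fix mon assume "mon \<in> Poly_Mapping.keys (p * q)"
    then obtain u v where "mon = u + v" "u \<in> Poly_Mapping.keys p" "v \<in> Poly_Mapping.keys q"
      using Poly_Mapping.keys_mult[of p q] by blast
    then show "Poly_Mapping.keys mon \<subseteq> S"
      using p q Poly_Mapping.keys_add[of u v] unfolding polys_def by blast
  qed
  show "- p \<in> polys S" if "p \<in> polys S"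
    using that unfolding polys_def by (simp add: in_keys_iff)
qed (auto simp: polys_def var_def)

lemma cring_poly_ring: "cring (poly_ring S :: 'k::comm_ring_1 mpoly ring)"
proof (rule cringI)
  show "abelian_group (poly_ring S :: 'k mpoly ring)"
  proof (rule abelian_groupI)
    fix p :: "'k mpoly" assume "p \<in> carrier (poly_ring S)"
    then show "\<exists>q\<in>carrier (poly_ring S). q \<oplus>\<^bsub>poly_ring S\<^esub> p = \<zero>\<^bsub>poly_ring S\<^esub>"
      by (intro bexI[of _ "- p"]) (simp_all add: poly_ring_def polys_closed)
  qed (simp_all add: poly_ring_def polys_closed add.assoc add.commute)
  show "Group.comm_monoid (poly_ring S :: 'k mpoly ring)"
    by (rule comm_monoidI) (simp_all add: poly_ring_def polys_closed mult.assoc mult.commute)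
qed (simp add: poly_ring_def distrib_right)

lemma minors_subset:
  assumes "S \<subseteq> U" "s \<ge> 1"
  shows "minors s S \<subseteq> carrier (poly_ring U)"
proof
  fix p :: "'k::comm_ring_1 mpoly"
  assume "p \<in> minors s S"
  then obtain R C where RC: "card R = s" "card C = s" "R \<times> C \<subseteq> S"
    and p: "p = det (mat s s (\<lambda>(i, j). var (sorted_list_of_set R ! i, sorted_list_of_set C ! j)))"
    unfolding minors_def by blast
  have fin: "finite R" "finite C" using RC assms by (auto intro: card_ge_0_finite)
  have nth: "sorted_list_of_set A ! i \<in> A" if "finite A" "card A = s" "i < s" for A :: "nat set" and i
    using that nth_mem[of i "sorted_list_of_set A"] by simp
  have sum: "sum f B \<in> polys U" if "\<And>x. x \<in> B \<Longrightarrow> f x \<in> polys U"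
    for f :: "(nat \<Rightarrow> nat) \<Rightarrow> 'k mpoly" and B
    using that by (induction B rule: infinite_finite_induct) (auto intro: polys_closed)
  have prod: "prod f B \<in> polys U" if "\<And>x. x \<in> B \<Longrightarrow> f x \<in> polys U"
    for f :: "nat \<Rightarrow> 'k mpoly" and B
    using that by (induction B rule: infinite_finite_induct) (auto intro: polys_closed)
  have entry: "var (sorted_list_of_set R ! i, sorted_list_of_set C ! j) \<in> polys U"
    if "i < s" "j < s" for i j
    using nth[OF fin(1) RC(1) that(1)] nth[OF fin(2) RC(2) that(2)] RC(3) assms(1)
    by (intro polys_closed(6)) blast
  have perm: "\<pi> i < s" if "\<pi> permutes {0..<s}" "i < s" for \<pi> i
    using permutes_in_image[OF that(1), of i] that(2) by simp
  have sign: "signof \<pi> \<in> (polys U :: 'k mpoly set)" for \<pi> :: "nat \<Rightarrow> nat"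
    by (simp add: sign_def polys_closed)
  have "p \<in> polys U"
    unfolding p Determinant.det_def
    by (simp, intro sum polys_closed(4) prod sign) (simp add: entry perm)
  then show "p \<in> carrier (poly_ring U)" by (simp add: poly_ring_def)
qed

end

theory Submission
  imports Defs "HOL-Library.Multiset_Order" "HOL-Library.Countable"
begin

text \<open>
  The ideal \<open>I\<^sub>t(L)\<close> is the kernel on \<open>K[L]\<close> of a homomorphism \<open>\<phi>\<close> into a polynomial ring, sending the
  matrix \<open>X\<close> to a sum of generic rank one matrices supported on suitable rectangles (blocks).  The
  blocks are chosen so that fewer than \<open>t\<^sub>j\<close> of them meet the region \<open>r \<le> d\<^sub>j\<close>, \<open>q \<ge> c\<^sub>j\<close>; hence \<open>\<phi>\<close> kills
  the \<open>t\<^sub>j\<close>-minors of that region, in particular those of \<open>X\<^sub>j\<close> and of \<open>L\<^sub>j\<close>, and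
  \<open>I\<^sub>t(X') \<inter> K[L] \<subseteq> ker \<phi> \<inter> K[L]\<close>.

  Conversely, give \<open>x\<^sub>r\<^sub>,\<^sub>q\<close> the weight \<open>(r - q)\<^sup>2\<close>.  If a monomial contains no antidiagonal of length \<open>t\<^sub>j\<close>
  inside \<open>L\<^sub>j\<close>, for any \<open>j\<close>, then layering its support by the length of the longest antidiagonal ending at
  a position decomposes it into weakly increasing chains, one for each block, and such a monomial
  cannot be of maximal weight in a polynomial killed by \<open>\<phi>\<close> (the initial ideal of a join is
  contained in the join of the initial ideals).  So a monomial of maximal weight in an element of the
  kernel contains such an antidiagonal.  By the shape of a ladder the whole minor lies in
  \<open>L\<^sub>j\<close>, its antidiagonal is its heaviest term, and a multiple of it can be subtracted.
\<close>

section \<open>Substitution homomorphisms and chains\<close>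

text \<open>Exponent vectors are read as multisets so that products over a monomial can be taken
  with \<open>image_mset\<close> and \<open>prod_mset\<close>.\<close>

definition mset_of :: "('a \<Rightarrow>\<^sub>0 nat) \<Rightarrow> 'a multiset" where
  "mset_of N = Abs_multiset (Poly_Mapping.lookup N)"

lemma count_mset_of [simp]: "count (mset_of N) v = Poly_Mapping.lookup N v"
  using finite_keys[of N] unfolding mset_of_def
  by (subst Abs_multiset_inverse) (auto simp: keys.rep_eq)

lemma mset_of_simps [simp]:
  "mset_of 0 = {#}" "mset_of (M + N) = mset_of M + mset_of N"
  "mset_of (Poly_Mapping.single v (Suc 0)) = {#v#}"
  by (auto intro!: multiset_eqI simp: lookup_add lookup_single when_def)

lemma mset_of_eq_iff [simp]: "mset_of M = mset_of N \<longleftrightarrow> M = N"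
  by (metis count_mset_of poly_mapping_eqI)

lemma set_mset_mset_of [simp]: "set_mset (mset_of N) = Poly_Mapping.keys N"
  by (auto simp: set_mset_def in_keys_iff)

lemma mset_of_surj: "\<exists>N. mset_of N = A"
proof
  show "mset_of (Abs_poly_mapping (count A)) = A"
    by (rule multiset_eqI) (simp add: set_mset_def[symmetric])
qed

lemma mset_of_sum: "mset_of (sum f I) = (\<Sum>i\<in>I. mset_of (f i))"
  by (induction I rule: infinite_finite_induct) auto

section \<open>Evaluation of polynomials at given values of the indeterminates\<close>

definition subst :: "('a \<Rightarrow> 'b multiset \<Rightarrow>\<^sub>0 'k) \<Rightarrow> (('a \<Rightarrow>\<^sub>0 nat) \<Rightarrow>\<^sub>0 'k::comm_ring_1) \<Rightarrow> 'b multiset \<Rightarrow>\<^sub>0 'k"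
  where "subst g p = (\<Sum>N\<in>Poly_Mapping.keys p.
    Poly_Mapping.single 0 (Poly_Mapping.lookup p N) * prod_mset (image_mset g (mset_of N)))"

lemma subst_superset:
  assumes "finite F" "Poly_Mapping.keys p \<subseteq> F"
  shows "subst g p = (\<Sum>N\<in>F.
    Poly_Mapping.single 0 (Poly_Mapping.lookup p N) * prod_mset (image_mset g (mset_of N)))"
  unfolding subst_def using assms
  by (intro sum.mono_neutral_left) (auto simp: in_keys_iff)

lemma subst_0 [simp]: "subst g 0 = 0"
  by (simp add: subst_def)

lemma subst_add: "subst g (p + q) = subst g p + subst g q"
proof -
  let ?F = "Poly_Mapping.keys p \<union> Poly_Mapping.keys q"
  have "Poly_Mapping.keys (p + q) \<subseteq> ?F" by (rule Poly_Mapping.keys_add)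
  then show ?thesis
    by (simp add: subst_superset[of ?F] lookup_add single_add distrib_right sum.distrib)
qed

lemma subst_sum: "subst g (sum f I) = (\<Sum>i\<in>I. subst g (f i))"
  by (induction I rule: infinite_finite_induct) (auto simp: subst_add)

lemma subst_single:
  "subst g (Poly_Mapping.single N a) = Poly_Mapping.single 0 a * prod_mset (image_mset g (mset_of N))"
  by (subst subst_superset[of "{N}"]) auto

lemma poly_mapping_sum_single: "p = (\<Sum>N\<in>Poly_Mapping.keys p. Poly_Mapping.single N (Poly_Mapping.lookup p N))"
  by (rule poly_mapping_eqI)
    (auto simp: lookup_sum lookup_single when_def sum.delta in_keys_iff)

lemma subst_mult: "subst g (p * q) = subst g p * subst g q"
proof -
  have "subst g (p * q) = subst g ((\<Sum>M\<in>Poly_Mapping.keys p. Poly_Mapping.single M (Poly_Mapping.lookup p M)) *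
     (\<Sum>N\<in>Poly_Mapping.keys q. Poly_Mapping.single N (Poly_Mapping.lookup q N)))"
    using poly_mapping_sum_single by metis
  also have "\<dots> = (\<Sum>M\<in>Poly_Mapping.keys p. \<Sum>N\<in>Poly_Mapping.keys q.
      subst g (Poly_Mapping.single M (Poly_Mapping.lookup p M) * Poly_Mapping.single N (Poly_Mapping.lookup q N)))"
    by (simp add: sum_product subst_sum)
  also have "\<dots> = (\<Sum>M\<in>Poly_Mapping.keys p. \<Sum>N\<in>Poly_Mapping.keys q.
      subst g (Poly_Mapping.single M (Poly_Mapping.lookup p M)) *
      subst g (Poly_Mapping.single N (Poly_Mapping.lookup q N)))"
    by (intro sum.cong refl) (simp add: mult_single subst_single ac_simps flip: mult_single[of 0 _ 0, simplified])
  also have "\<dots> = subst g p * subst g q"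
    by (simp add: sum_product subst_single) (simp add: subst_def sum_product)
  finally show ?thesis .
qed

lemma comm_ring_hom_subst: "comm_ring_hom (subst g)"
proof
  show "subst g 1 = 1" using subst_single[of g 0 1] by simp
qed (simp_all add: subst_add subst_mult)

lemma subst_var [simp]: "subst g (var v) = g v"
  using subst_single[of g "Poly_Mapping.single v 1" 1] unfolding var_def by simp

text \<open>Exchange argument. A chain contains the position of least row and least column; if
  \<open>A\<close> contains it too, it is cancelled, and otherwise a swap brings it into
  \<open>A\<close> and strictly lowers the weight. The order of the columns enters through
  \<open>g\<close>, so that increasing chains and, with \<open>g\<close> decreasing, antidiagonals
  are both covered.\<close>

lemma chain_minimal_weight:
  fixes w :: "nat \<times> nat \<Rightarrow> int" and g :: "nat \<Rightarrow> int"
  assumes "inj g"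
    and w: "\<And>r r' q q'. r < r' \<Longrightarrow> g q < g q' \<Longrightarrow> w (r, q) + w (r', q') < w (r, q') + w (r', q)"
    and "\<And>r r' q q'. (r, q) \<in># M \<Longrightarrow> (r', q') \<in># M \<Longrightarrow> r < r' \<Longrightarrow> g q \<le> g q'"
    and "image_mset fst A = image_mset fst M" "image_mset snd A = image_mset snd M"
  shows "A = M \<or> sum_mset (image_mset w M) < sum_mset (image_mset w A)"
  using assms(3-5)
proof (induction "size M" arbitrary: M A)
  case 0
  then show ?case by simp
next
  case (Suc n)
  have fin: "finite (set_mset M)" and ne: "set_mset M \<noteq> {}" using Suc.hyps(2) by auto
  define r0 where "r0 = Min (fst ` set_mset M)"
  have r0: "r0 \<in> fst ` set_mset M" and r0_le: "\<And>r q. (r, q) \<in># M \<Longrightarrow> r0 \<le> r"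
    unfolding r0_def using fin ne by (force intro: Min_in Min_le)+
  define y0 where "y0 = Min ((g \<circ> snd) ` set_mset M)"
  have y0: "y0 \<in> (g \<circ> snd) ` set_mset M" and y0_le: "\<And>r q. (r, q) \<in># M \<Longrightarrow> y0 \<le> g q"
    unfolding y0_def using fin ne by (force intro: Min_in Min_le)+
  obtain q1 r1 q0 where q1: "(r0, q1) \<in># M" and q0: "(r1, q0) \<in># M" "g q0 = y0"
    using r0 y0 by auto
  \<comment> \<open>If the entry in the least column lies below row \<open>r0\<close>, the chain
    condition forces the entry in row \<open>r0\<close> into that same column.\<close>
  have M0: "(r0, q0) \<in># M"
  proof (cases "r0 < r1")
    case True
    then have "g q1 = g q0" using Suc.prems(1)[OF q1 q0(1)] y0_le[OF q1] q0(2) by simp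
    then show ?thesis using q1 \<open>inj g\<close> by (auto dest: injD)
  next
    case False
    then show ?thesis using q0 r0_le[OF q0(1)] by simp
  qed
  define M' where "M' = M - {#(r0, q0)#}"
  have M: "M = add_mset (r0, q0) M'" using M0 by (simp add: M'_def)
  have step: "A' = M \<or> sum_mset (image_mset w M) < sum_mset (image_mset w A')"
    if "image_mset fst A' = image_mset fst M" "image_mset snd A' = image_mset snd M"
      and mem: "(r0, q0) \<in># A'" for A'
  proof -
    obtain A'' where A'': "A' = add_mset (r0, q0) A''" using mem by (meson multi_member_split)
    have "A'' = M' \<or> sum_mset (image_mset w M') < sum_mset (image_mset w A'')"
      using Suc.hyps(2) that(1,2) Suc.prems(1)
      by (intro Suc.hyps(1)) (auto simp: M A'')
    then show ?thesis by (auto simp: M A'')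
  qed
  have "set_mset (image_mset fst A) = set_mset (image_mset fst M)"
    "set_mset (image_mset snd A) = set_mset (image_mset snd M)" using Suc.prems by simp_all
  then have sets: "fst ` set_mset A = fst ` set_mset M" "snd ` set_mset A = snd ` set_mset M"
    by simp_all
  have "r0 \<in> fst ` set_mset A" "q0 \<in> snd ` set_mset A" using sets M0 by force+
  then obtain q r where qA: "(r0, q) \<in># A" and rA: "(r, q0) \<in># A" by auto
  have "q \<in> snd ` set_mset M" "r \<in> fst ` set_mset M"
    using sets qA rA by force+
  then have "g q0 \<le> g q" "r0 \<le> r" using y0_le r0_le q0(2) by auto
  show ?case
  proof (cases "r = r0 \<or> q = q0")
    case True
    then show ?thesis using step[of A] Suc.prems qA rA by auto
  next
    case False
    then have lt: "r0 < r" "g q0 < g q"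
      using \<open>g q0 \<le> g q\<close> \<open>r0 \<le> r\<close> \<open>inj g\<close> by (auto simp: less_le dest: injD)
    obtain B where B: "A = add_mset (r0, q) B" using qA by (meson multi_member_split)
    moreover have "(r, q0) \<in># B" using rA False by (auto simp: B)
    then obtain B' where "B = add_mset (r, q0) B'" by (meson multi_member_split)
    ultimately have A: "A = add_mset (r0, q) (add_mset (r, q0) B')" by simp
    \<comment> \<open>Swapping the two columns keeps both margins.\<close>
    let ?A' = "add_mset (r0, q0) (add_mset (r, q) B')"
    have "sum_mset (image_mset w ?A') < sum_mset (image_mset w A)"
      using w[OF lt] by (simp add: A)
    moreover have "?A' = M \<or> sum_mset (image_mset w M) < sum_mset (image_mset w ?A')"
      using Suc.prems by (intro step) (auto simp: A add_mset_commute)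
    ultimately show ?thesis by auto
  qed
qed

section \<open>Sums of rank one matrices\<close>

text \<open>
  For a block \<open>e\<close> the monomial of \<open>cell e (r, q)\<close> stands for \<open>y\<^sub>e\<^sub>,\<^sub>r z\<^sub>e\<^sub>,\<^sub>q\<close>.  Monomials of the target
  ring are multisets of codes of indeterminates: the multiset order makes that ring an integral
  domain by a library instance.
\<close>

definition cell :: "nat \<times> nat \<Rightarrow> nat \<times> nat \<Rightarrow> nat multiset" where
  "cell e v = {#to_nat (e, False, fst v), to_nat (e, True, snd v)#}"

definition cells :: "((nat \<times> nat) \<times> (nat \<times> nat)) multiset \<Rightarrow> nat multiset" where
  "cells A = (\<Sum>x\<in>#A. cell (fst x) (snd x))"

definition part :: "'e \<Rightarrow> ('e \<times> 'v) multiset \<Rightarrow> 'v multiset" where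
  "part e A = image_mset snd (filter_mset (\<lambda>x. fst x = e) A)"

lemma part_simps [simp]:
  "part e {#} = {#}"
  "part e (add_mset x A) = (if fst x = e then add_mset (snd x) (part e A) else part e A)"
  by (auto simp: part_def)

lemma count_part: "count (part e A) v = count A (e, v)"
  by (induction A) auto

lemma part_eqD: "(\<And>e. part e A = part e B) \<Longrightarrow> A = B"
  by (rule multiset_eqI) (metis count_part surj_pair)

lemma sum_part:
  assumes "finite E" "fst ` set_mset A \<subseteq> E"
  shows "(\<Sum>x\<in>#A. f (snd x) :: int) = (\<Sum>e\<in>E. \<Sum>v\<in>#part e A. f v)"
  using assms(2)
proof (induction A)
  case (add x A)
  have "(\<Sum>v\<in>#part e (add_mset x A). f v) = (if fst x = e then f (snd x) else 0) + (\<Sum>v\<in>#part e A. f v)" for e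
    by simp
  then have "(\<Sum>e\<in>E. \<Sum>v\<in>#part e (add_mset x A). f v) =
      (\<Sum>e\<in>E. (if fst x = e then f (snd x) else 0) + (\<Sum>v\<in>#part e A. f v))"
    by (intro sum.cong) auto
  then show ?case using add assms(1) by (simp add: sum.distrib sum.delta)
qed simp

text \<open>The codes in \<open>cells A\<close> record the block, the kind (row or column) and the
  index. Only the pairing of rows with columns inside a block is lost.\<close>

lemma margins_part:
  assumes "cells A = cells B"
  shows "image_mset fst (part e A) = image_mset fst (part e B)"
    and "image_mset snd (part e A) = image_mset snd (part e B)"
proof -
  let ?dec = "from_nat :: nat \<Rightarrow> (nat \<times> nat) \<times> bool \<times> nat"
  have "image_mset fst (part e A) = image_mset (snd \<circ> snd \<circ> ?dec)
      (filter_mset (\<lambda>n. fst (?dec n) = e \<and> \<not> fst (snd (?dec n))) (cells A))" for A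
    by (induction A) (auto simp: cells_def cell_def)
  then show "image_mset fst (part e A) = image_mset fst (part e B)" using assms by simp
  have "image_mset snd (part e A) = image_mset (snd \<circ> snd \<circ> ?dec)
      (filter_mset (\<lambda>n. fst (?dec n) = e \<and> fst (snd (?dec n))) (cells A))" for A
    by (induction A) (auto simp: cells_def cell_def)
  then show "image_mset snd (part e A) = image_mset snd (part e B)" using assms by simp
qed

text \<open>With \<open>\<Lambda> v\<close> the set of blocks that cover \<open>v\<close>, this is
  the entry at \<open>v\<close> of a sum of generic rank one matrices, one for each block.\<close>

definition rank_one_sum ::
    "(nat \<times> nat \<Rightarrow> (nat \<times> nat) set) \<Rightarrow> nat \<times> nat \<Rightarrow> nat multiset \<Rightarrow>\<^sub>0 'k::comm_ring_1" where
  "rank_one_sum \<Lambda> v = (\<Sum>e\<in>\<Lambda> v. Poly_Mapping.single (cell e v) 1)"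

lemma keys_rank_one_sum: "Poly_Mapping.keys (rank_one_sum \<Lambda> v) \<subseteq> (\<lambda>e. cell e v) ` \<Lambda> v"
proof -
  have "Poly_Mapping.keys (rank_one_sum \<Lambda> v) \<subseteq>
      (\<Union>e\<in>\<Lambda> v. Poly_Mapping.keys (Poly_Mapping.single (cell e v) (1 :: 'a)))"
    unfolding rank_one_sum_def by (rule order_trans[OF Poly_Mapping.keys_sum]) simp
  then show ?thesis by (auto split: if_splits)
qed

text \<open>Expanding the product chooses a block for each factor of \<open>N\<close>;
  \<open>A\<close> is \<open>N\<close> labelled by these choices.\<close>

lemma keys_prod_rank_one_sum:
  "Poly_Mapping.keys (\<Prod>v\<in>#N. rank_one_sum \<Lambda> v :: nat multiset \<Rightarrow>\<^sub>0 'k::comm_ring_1)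
    \<subseteq> {cells A | A. image_mset snd A = N}"
proof (induction N)
  case empty
  then show ?case by (auto simp: cells_def)
next
  case (add v N)
  show ?case
  proof
    fix T assume "T \<in> Poly_Mapping.keys (\<Prod>v\<in>#add_mset v N. rank_one_sum \<Lambda> v :: nat multiset \<Rightarrow>\<^sub>0 'k)"
    then obtain B U where T: "T = B + U"
      "B \<in> Poly_Mapping.keys (rank_one_sum \<Lambda> v :: nat multiset \<Rightarrow>\<^sub>0 'k)"
      "U \<in> Poly_Mapping.keys (\<Prod>v\<in>#N. rank_one_sum \<Lambda> v :: nat multiset \<Rightarrow>\<^sub>0 'k)"
      using Poly_Mapping.keys_mult[of "rank_one_sum \<Lambda> v :: nat multiset \<Rightarrow>\<^sub>0 'k"] by fastforce
    obtain e where e: "B = cell e v" using T(2) keys_rank_one_sum by blast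
    obtain A where A: "U = cells A" "image_mset snd A = N" using T(3) add by auto
    show "T \<in> {cells A | A. image_mset snd A = add_mset v N}"
      using A by (intro CollectI exI[of _ "add_mset (e, v) A"]) (auto simp: T(1) e cells_def)
  qed
qed

text \<open>The choice of \<open>lay\<close> at every position is split off, with coefficient 1.
  Another labelling may still have the same \<open>cells\<close>; for chains this is excluded later,
  by weight.\<close>

lemma prod_rank_one_sum_expansion:
  fixes \<Lambda> :: "nat \<times> nat \<Rightarrow> (nat \<times> nat) set"
  assumes "\<And>v. finite (\<Lambda> v)" "\<And>v. v \<in># N \<Longrightarrow> lay v \<in> \<Lambda> v"
  shows "Poly_Mapping.keys ((\<Prod>v\<in>#N. rank_one_sum \<Lambda> v :: nat multiset \<Rightarrow>\<^sub>0 'k::comm_ring_1) -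
      Poly_Mapping.single (cells (image_mset (\<lambda>v. (lay v, v)) N)) 1)
    \<subseteq> {cells A | A. image_mset snd A = N \<and> A \<noteq> image_mset (\<lambda>v. (lay v, v)) N}"
proof -
  define D where "D N = image_mset (\<lambda>v. (lay v, v)) N" for N
  define P where "P N = (\<Prod>v\<in>#N. rank_one_sum \<Lambda> v :: nat multiset \<Rightarrow>\<^sub>0 'k)" for N
  \<comment> \<open>Being different is expressed by a wrongly labelled position, a property that
    survives adding further positions.\<close>
  have "Poly_Mapping.keys (P N - Poly_Mapping.single (cells (D N)) 1)
    \<subseteq> {cells A | A. image_mset snd A = N \<and> (\<exists>x\<in>#A. fst x \<noteq> lay (snd x))}" (is "?K N \<subseteq> ?R N")
    using assms(2)
  proof (induction N)
    case empty
    then show ?case by (simp add: cells_def P_def D_def)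
  next
    case (add v N)
    let ?s = "\<lambda>T. Poly_Mapping.single T (1 :: 'k)"
    let ?rest = "\<Sum>e\<in>\<Lambda> v - {lay v}. ?s (cell e v)"
    have rv: "rank_one_sum \<Lambda> v = ?s (cell (lay v) v) + ?rest"
      unfolding rank_one_sum_def using assms(1) add.prems by (intro sum.remove) auto
    have D: "?s (cells (D (add_mset v N))) = ?s (cell (lay v) v) * ?s (cells (D N))"
      by (simp add: D_def cells_def mult_single)
    \<comment> \<open>Either the mislabelled position is among the others, with any block for
      \<open>v\<close>, or \<open>v\<close> itself is mislabelled and the others follow
      \<open>lay\<close>.\<close>
    have alg: "(x + y) * p - x * z = (x + y) * (p - z) + y * z" for x y p z :: "nat multiset \<Rightarrow>\<^sub>0 'k"
      by (simp add: algebra_simps)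
    have "P (add_mset v N) - ?s (cells (D (add_mset v N))) =
        rank_one_sum \<Lambda> v * (P N - ?s (cells (D N))) + ?rest * ?s (cells (D N))"
      unfolding D rv alg[symmetric] by (simp only: P_def image_mset_add_mset prod_mset.add_mset rv)
    then have "?K (add_mset v N) \<subseteq>
        Poly_Mapping.keys (rank_one_sum \<Lambda> v * (P N - ?s (cells (D N)))) \<union>
        Poly_Mapping.keys (?rest * ?s (cells (D N)))"
      by (simp add: Poly_Mapping.keys_add)
    moreover have "Poly_Mapping.keys (rank_one_sum \<Lambda> v * (P N - ?s (cells (D N)))) \<subseteq> ?R (add_mset v N)"
    proof
      fix T assume "T \<in> Poly_Mapping.keys (rank_one_sum \<Lambda> v * (P N - ?s (cells (D N))))"
      then obtain B U where T: "T = B + U"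
        "B \<in> Poly_Mapping.keys (rank_one_sum \<Lambda> v :: nat multiset \<Rightarrow>\<^sub>0 'k)" "U \<in> ?K N"
        using Poly_Mapping.keys_mult by blast
      obtain e where e: "B = cell e v" using T(2) keys_rank_one_sum by blast
      have "?K N \<subseteq> ?R N" using add by simp
      then obtain A where A: "U = cells A" "image_mset snd A = N" "\<exists>x\<in>#A. fst x \<noteq> lay (snd x)"
        using T(3) by blast
      show "T \<in> ?R (add_mset v N)"
        using A by (intro CollectI exI[of _ "add_mset (e, v) A"]) (auto simp: T(1) e cells_def)
    qed
    moreover have "Poly_Mapping.keys (?rest * ?s (cells (D N))) \<subseteq> ?R (add_mset v N)"
    proof
      fix T assume "T \<in> Poly_Mapping.keys (?rest * ?s (cells (D N)))"
      then obtain B where T: "T = B + cells (D N)" "B \<in> Poly_Mapping.keys ?rest"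
        using Poly_Mapping.keys_mult[of ?rest "?s (cells (D N))"] by auto
      then obtain e where "e \<in> \<Lambda> v - {lay v}" "B = cell e v"
        using keys_rank_one_sum[of "\<lambda>v. \<Lambda> v - {lay v}" v, where ?'a = 'k]
        unfolding rank_one_sum_def by blast
      then show "T \<in> ?R (add_mset v N)"
        by (intro CollectI exI[of _ "add_mset (e, v) (D N)"])
          (auto simp: T(1) cells_def D_def multiset.map_comp o_def)
    qed
    ultimately show ?case by blast
  qed
  moreover have "A \<noteq> D N" if "\<exists>x\<in>#A. fst x \<noteq> lay (snd x)" for A
    using that by (auto simp: D_def)
  ultimately show ?thesis unfolding P_def[symmetric] D_def[symmetric] by blast
qed

text \<open>
  The weights \<open>(r - q)\<^sup>2\<close> make the antidiagonal term of every minor the heaviest one.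
\<close>

definition wt :: "nat \<times> nat \<Rightarrow> int" where
  "wt v = (int (fst v) - int (snd v))\<^sup>2"

lemma wt_exchange:
  assumes "r < r'" "q < q'"
  shows "wt (r, q) + wt (r', q') < wt (r, q') + wt (r', q)"
proof -
  have "0 < (int r' - int r) * (int q' - int q)" using assms by simp
  then show ?thesis by (simp add: wt_def power2_eq_square algebra_simps)
qed

text \<open>Equality of \<open>cells\<close> fixes the rows and columns used in each block, so the
  exchange lemma applies to the blocks separately. The weights add up, and one differing block makes
  the total strictly larger.\<close>

lemma layered_minimal_weight:
  assumes chain: "\<And>v v'. v \<in># M \<Longrightarrow> v' \<in># M \<Longrightarrow> lay v = lay v' \<Longrightarrow> fst v < fst v' \<Longrightarrow> snd v \<le> snd v'"
    and eq: "cells A = cells (image_mset (\<lambda>v. (lay v, v)) M)"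
  shows "A = image_mset (\<lambda>v. (lay v, v)) M \<or> (\<Sum>v\<in>#M. wt v) < (\<Sum>x\<in>#A. wt (snd x))"
proof -
  define D where "D = image_mset (\<lambda>v. (lay v, v)) M"
  have part_D: "v \<in># part e D \<longleftrightarrow> v \<in># M \<and> lay v = e" for v e
    by (force simp: part_def D_def)
  have min: "part e A = part e D \<or> (\<Sum>v\<in>#part e D. wt v) < (\<Sum>v\<in>#part e A. wt v)" for e
    using eq chain
    by (intro chain_minimal_weight[where g = int])
      (auto simp: part_D margins_part[OF eq] wt_exchange inj_on_def simp flip: D_def)
  let ?E = "fst ` set_mset A \<union> fst ` set_mset D"
  have sums: "(\<Sum>x\<in>#A. wt (snd x)) = (\<Sum>e\<in>?E. \<Sum>v\<in>#part e A. wt v)"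
    "(\<Sum>x\<in>#D. wt (snd x)) = (\<Sum>e\<in>?E. \<Sum>v\<in>#part e D. wt v)" by (rule sum_part; simp)+
  have D: "(\<Sum>x\<in>#D. wt (snd x)) = (\<Sum>v\<in>#M. wt v)" by (simp add: D_def multiset.map_comp o_def)
  show ?thesis
  proof (cases "\<forall>e. part e A = part e D")
    case True
    then show ?thesis using part_eqD unfolding D_def by blast
  next
    case False
    then obtain e where e: "part e A \<noteq> part e D" by blast
    have "e \<in> ?E"
    proof (rule ccontr)
      assume "e \<notin> ?E"
      then have "part e A = {#}" "part e D = {#}" by (force simp: part_def filter_mset_eq_conv)+
      then show False using e by simp
    qed
    then have "(\<Sum>e\<in>?E. \<Sum>v\<in>#part e D. wt v) < (\<Sum>e\<in>?E. \<Sum>v\<in>#part e A. wt v)"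
    proof (intro sum_strict_mono_ex1 ballI)
      show "(\<Sum>v\<in>#part e' D. wt v) \<le> (\<Sum>v\<in>#part e' A. wt v)" for e'
        using min[of e'] by fastforce
      show "\<exists>e\<in>?E. (\<Sum>v\<in>#part e D. wt v) < (\<Sum>v\<in>#part e A. wt v)"
        using min[of e] e \<open>e \<in> ?E\<close> by blast
    qed simp
    then show ?thesis using sums D by simp
  qed
qed

lemma lookup_single_0_mult: "Poly_Mapping.lookup (Poly_Mapping.single 0 a * p) T = a * Poly_Mapping.lookup p T"
  by (simp add: Poly_Mapping.map.rep_eq when_def flip: mult_map_scale_conv_mult)

text \<open>
  If \<open>M\<close> split into chains, one per block, then the monomial \<open>\<Prod>v. cell (lay v) v\<close> would occur in the
  image of \<open>M\<close> exactly once and in the image of no other monomial of weight at most that of \<open>M\<close>,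
  because a chain is the unique lightest monomial with its row and column contents.
\<close>

lemma layered_not_leading:
  fixes f :: "'k::comm_ring_1 mpoly"
  assumes fin: "\<And>v. finite (\<Lambda> v)" and f: "subst (rank_one_sum \<Lambda>) f = 0"
    and M: "M \<in> Poly_Mapping.keys f"
    and max: "\<And>N. N \<in> Poly_Mapping.keys f \<Longrightarrow> (\<Sum>v\<in>#mset_of N. wt v) \<le> (\<Sum>v\<in>#mset_of M. wt v)"
    and \<Lambda>: "\<And>v. v \<in> Poly_Mapping.keys M \<Longrightarrow> lay v \<in> \<Lambda> v"
  shows "\<exists>v\<in>Poly_Mapping.keys M. \<exists>v'\<in>Poly_Mapping.keys M. lay v = lay v' \<and> fst v < fst v' \<and> snd v' < snd v"
proof (rule ccontr)
  assume "\<not> ?thesis"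
  then have chain: "snd v \<le> snd v'" if "v \<in># mset_of M" "v' \<in># mset_of M" "lay v = lay v'" "fst v < fst v'" for v v'
    using that by fastforce
  let ?D = "image_mset (\<lambda>v. (lay v, v)) (mset_of M)"
  let ?P = "\<lambda>N. (\<Prod>v\<in>#mset_of N. rank_one_sum \<Lambda> v :: nat multiset \<Rightarrow>\<^sub>0 'k)"
  \<comment> \<open>Another labelling of the same positions has the same total weight, so by
    minimality none has the \<open>cells\<close> of \<open>?D\<close>.\<close>
  have "Poly_Mapping.lookup (?P M - Poly_Mapping.single (cells ?D) 1) (cells ?D) = 0"
  proof (rule ccontr)
    assume "\<not> ?thesis"
    then have "cells ?D \<in> Poly_Mapping.keys (?P M - Poly_Mapping.single (cells ?D) 1)"
      by (simp add: in_keys_iff)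
    then obtain A where A: "cells A = cells ?D" "image_mset snd A = mset_of M" "A \<noteq> ?D"
      using prod_rank_one_sum_expansion[of \<Lambda> "mset_of M" lay, where ?'k = 'k] fin \<Lambda> by fastforce
    moreover have "(\<Sum>x\<in>#A. wt (snd x)) = (\<Sum>v\<in>#mset_of M. wt v)"
      by (simp add: A(2)[symmetric] multiset.map_comp o_def)
    moreover have "A = ?D \<or> (\<Sum>v\<in>#mset_of M. wt v) < (\<Sum>x\<in>#A. wt (snd x))"
      using chain A(1) by (rule layered_minimal_weight)
    ultimately show False by linarith
  qed
  then have 1: "Poly_Mapping.lookup (?P M) (cells ?D) = 1" by (simp add: lookup_minus)
  have 0: "Poly_Mapping.lookup (?P N) (cells ?D) = 0" if "N \<in> Poly_Mapping.keys f" "N \<noteq> M" for N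
  proof (rule ccontr)
    assume "\<not> ?thesis"
    then have "cells ?D \<in> Poly_Mapping.keys (?P N)" by (simp add: in_keys_iff)
    then obtain A where A: "cells A = cells ?D" "image_mset snd A = mset_of N"
      using keys_prod_rank_one_sum[of \<Lambda> "mset_of N", where ?'k = 'k] by fastforce
    have "A \<noteq> ?D" using A(2) that(2) by (auto simp: multiset.map_comp o_def)
    moreover have "(\<Sum>x\<in>#A. wt (snd x)) = (\<Sum>v\<in>#mset_of N. wt v)"
      by (simp add: A(2)[symmetric] multiset.map_comp o_def)
    moreover have "A = ?D \<or> (\<Sum>v\<in>#mset_of M. wt v) < (\<Sum>x\<in>#A. wt (snd x))"
      using chain A(1) by (rule layered_minimal_weight)
    ultimately show False using max[OF that(1)] by linarith
  qed
  have "0 = Poly_Mapping.lookup (subst (rank_one_sum \<Lambda>) f) (cells ?D)" by (simp add: f)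
  also have "\<dots> = (\<Sum>N\<in>Poly_Mapping.keys f. Poly_Mapping.lookup f N * Poly_Mapping.lookup (?P N) (cells ?D))"
    unfolding subst_def by (simp only: lookup_sum lookup_single_0_mult)
  also have "\<dots> = Poly_Mapping.lookup f M"
    using M 0 1 by (subst sum.remove[OF finite_keys M]) simp
  finally show False using M by (simp add: in_keys_iff)
qed

section \<open>Leading terms of minors\<close>

lemma det_sum_rank_one_eq_0:
  fixes y z :: "nat \<Rightarrow> nat \<Rightarrow> 'a::comm_ring_1"
  assumes "1 \<le> s"
  shows "det (mat s s (\<lambda>(i, j). \<Sum>l\<in>{1..<s}. y l i * z l j)) = 0"
proof -
  \<comment> \<open>The terms are \<open>s - 1\<close> in number; column \<open>0\<close> of the left factor is padded with zeros.\<close>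
  define A where "A = mat s s (\<lambda>(i, l). if l = 0 then 0 else y l i)"
  define B where "B = mat s s (\<lambda>(l, j). z l j)"
  have "mat s s (\<lambda>(i, j). \<Sum>l\<in>{1..<s}. y l i * z l j) = A * B"
  proof (rule eq_matI)
    fix i j assume "i < dim_row (A * B)" "j < dim_col (A * B)"
    then have ij: "i < s" "j < s" by (auto simp: A_def B_def)
    have "(A * B) $$ (i, j) = (\<Sum>l\<in>{0..<s}. (if l = 0 then 0 else y l i) * z l j)"
      using ij by (simp add: A_def B_def scalar_prod_def)
    also have "\<dots> = (\<Sum>l\<in>{1..<s}. y l i * z l j)"
      using assms by (intro sum.mono_neutral_cong_right) auto
    finally show "mat s s (\<lambda>(i, j). \<Sum>l\<in>{1..<s}. y l i * z l j) $$ (i, j) = (A * B) $$ (i, j)"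
      using ij by simp
  qed (auto simp: A_def B_def)
  moreover have "det A = 0"
  proof -
    have "(\<Prod>i = 0..<s. A $$ (i, p i)) = 0" if p: "p permutes {0..<s}" for p
    proof (rule prod_zero)
      have "0 \<in> p ` {0..<s}" using permutes_image[OF p] assms by auto
      then show "\<exists>i\<in>{0..<s}. A $$ (i, p i) = 0" using assms by (force simp: A_def)
    qed simp
    then show ?thesis unfolding Determinant.det_def by (auto simp: A_def)
  qed
  moreover have "det (A * B) = det A * det B"
    by (rule det_mult[of _ s]) (auto simp: A_def B_def)
  ultimately show ?thesis by simp
qed

lemma prod_var: "(\<Prod>i\<in>I. var (f i)) = (Poly_Mapping.single (\<Sum>i\<in>I. Poly_Mapping.single (f i) 1) 1 :: 'k::comm_ring_1 mpoly)"
proof (induction I rule: infinite_finite_induct)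
  case (insert i I)
  then show ?case by (simp add: var_def mult_single)
qed simp_all

section \<open>Antidiagonals as heaviest terms of minors\<close>

definition antidiag :: "(nat \<times> nat) set \<Rightarrow> bool" where
  "antidiag D \<longleftrightarrow> (\<forall>x\<in>D. \<forall>y\<in>D. x \<noteq> y \<longrightarrow>
    fst x < fst y \<and> snd y < snd x \<or> fst y < fst x \<and> snd x < snd y)"

lemma antidiag_inj:
  assumes "antidiag D"
  shows "inj_on fst D" "inj_on snd D"
  using assms unfolding antidiag_def inj_on_def by (metis less_irrefl)+

definition weight :: "(nat \<times> nat \<Rightarrow>\<^sub>0 nat) \<Rightarrow> int" where
  "weight N = (\<Sum>v\<in>#mset_of N. wt v)"

lemma weight_add: "weight (M + N) = weight M + weight N"
  by (simp add: weight_def)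

lemma weight_nonneg: "0 \<le> weight N"
proof -
  have "0 \<le> (\<Sum>v\<in>#A. wt v)" for A by (induction A) (auto simp: wt_def)
  then show ?thesis by (simp add: weight_def)
qed

text \<open>Reversing the columns turns an antidiagonal into an increasing chain, and negating the
  weights keeps the exchange inequality; thus \<open>chain_minimal_weight\<close> applies.\<close>

lemma antidiag_leading:
  assumes D: "antidiag D" and R: "image_mset fst A = mset_set (fst ` D)"
    and C: "image_mset snd A = mset_set (snd ` D)"
  shows "A = mset_set D \<or> (\<Sum>v\<in>#A. wt v) < (\<Sum>v\<in>#mset_set D. wt v)"
proof -
  have neg: "(\<Sum>v\<in>#B. - wt v) = - (\<Sum>v\<in>#B. wt v)" for B
    by (induction B) auto
  have "A = mset_set D \<or> (\<Sum>v\<in>#mset_set D. - wt v) < (\<Sum>v\<in>#A. - wt v)"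
  proof (rule chain_minimal_weight[where g = "\<lambda>q. - int q"])
    show "- wt (r, q) + - wt (r', q') < - wt (r, q') + - wt (r', q)"
      if "r < r'" "- int q < - int q'" for r r' q q'
      using wt_exchange[of r r' q' q] that by simp
    show "- int q \<le> - int q'"
      if "(r, q) \<in># mset_set D" "(r', q') \<in># mset_set D" "r < r'" for r r' q q'
    proof -
      \<comment> \<open>\<open>D\<close> may be infinite here; then \<open>mset_set D\<close> is
        empty.\<close>
      have "(r, q) \<in> D" "(r', q') \<in> D"
        using that by (metis elem_mset_set infinite_set_mset_mset_set empty_iff)+
      then show ?thesis using D that(3) unfolding antidiag_def by fastforce
    qed
  qed (use R C antidiag_inj[OF D] in \<open>auto simp: image_mset_mset_set inj_on_def\<close>)
  then show ?thesis by (simp add: neg)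
qed

text \<open>The terms of the minor are indexed by permutations; one of them is the product over
  \<open>D\<close>, and \<open>antidiag_leading\<close> makes all others lighter. The coefficient
  \<open>\<epsilon>\<close> is a sign, hence its own inverse.\<close>

lemma antidiag_minor:
  assumes D: "antidiag D" "finite D"
  obtains N and \<epsilon> :: "'k::comm_ring_1" and \<mu>
  where "\<mu> \<in> minors (card D) (fst ` D \<times> snd ` D)" "mset_of N = mset_set D" "\<epsilon> * \<epsilon> = 1"
    "\<And>Q. Q \<in> Poly_Mapping.keys (\<mu> - Poly_Mapping.single N \<epsilon>) \<Longrightarrow> weight Q < weight N"
proof -
  let ?s = "card D" and ?R = "fst ` D" and ?C = "snd ` D"
  let ?\<rho> = "(!) (sorted_list_of_set ?R)" and ?\<gamma> = "(!) (sorted_list_of_set ?C)"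
  note inj = antidiag_inj[OF D(1)]
  have len: "length (sorted_list_of_set ?R) = ?s" "length (sorted_list_of_set ?C) = ?s"
    using inj by (simp_all add: card_image)
  have bij: "bij_betw ?\<rho> {0..<?s} ?R" "bij_betw ?\<gamma> {0..<?s} ?C"
    using len D(2) by (intro bij_betw_nth; simp add: atLeast0LessThan)+
  define P where "P = {p. p permutes {0..<?s}}"
  define N where "N p = (\<Sum>i\<in>{0..<?s}. Poly_Mapping.single (?\<rho> i, ?\<gamma> (p i)) 1 :: nat \<times> nat \<Rightarrow>\<^sub>0 nat)" for p
  define \<mu> :: "'k mpoly" where "\<mu> = det (mat ?s ?s (\<lambda>(i, j). var (?\<rho> i, ?\<gamma> j)))"
  have fin: "finite P" by (simp add: P_def finite_permutations)
  have \<mu>: "\<mu> = (\<Sum>p\<in>P. Poly_Mapping.single (N p) (signof p))"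
  proof -
    have sign: "signof p * Poly_Mapping.single M 1 = (Poly_Mapping.single M (signof p) :: 'k mpoly)"
      for p :: "nat \<Rightarrow> nat" and M
      by (simp add: sign_def single_uminus)
    have "\<mu> = (\<Sum>p\<in>P. signof p * (\<Prod>i = 0..<?s. var (?\<rho> i, ?\<gamma> (p i))))"
      unfolding \<mu>_def Determinant.det_def P_def by (auto intro!: sum.cong prod.cong simp: permutes_in_image)
    also have "\<dots> = (\<Sum>p\<in>P. Poly_Mapping.single (N p) (signof p))"
      unfolding prod_var N_def sign ..
    finally show ?thesis .
  qed
  have mset_N: "mset_of (N p) = image_mset (\<lambda>i. (?\<rho> i, ?\<gamma> (p i))) (mset_set {0..<?s})" for p
    unfolding N_def mset_of_sum by (simp add: sum_unfold_sum_mset)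
  \<comment> \<open>Distinct permutations give distinct monomials, so only one of them yields
    \<open>D\<close>.\<close>
  have inj_N: "p = p'" if p: "p \<in> P" "p' \<in> P" and eq: "N p = N p'" for p p'
  proof
    fix i
    show "p i = p' i"
    proof (cases "i < ?s")
      case True
      then have "(?\<rho> i, ?\<gamma> (p i)) \<in># mset_of (N p')" unfolding eq[symmetric] mset_N by auto
      then obtain i' where i': "i' < ?s" "?\<rho> i = ?\<rho> i'" "?\<gamma> (p i) = ?\<gamma> (p' i')" unfolding mset_N by auto
      have "i = i'" using i' True bij(1) by (auto simp: bij_betw_def inj_on_def)
      moreover have "p i < ?s" "p' i' < ?s"
        using p i'(1) True permutes_in_image[of p "{0..<?s}" i] permutes_in_image[of p' "{0..<?s}" i']
        by (auto simp: P_def)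
      ultimately show ?thesis using i' bij(2) by (auto simp: bij_betw_def inj_on_def)
    next
      case False
      then show ?thesis using p by (simp add: P_def permutes_def)
    qed
  qed
  have ex: "\<exists>p\<in>P. mset_of (N p) = mset_set D"
  proof -
    \<comment> \<open>The index of a row goes to the element of \<open>D\<close> in that row, and
      then to the index of its column.\<close>
    let ?q = "inv_into {0..<?s} ?\<gamma> \<circ> (snd \<circ> (inv_into D fst \<circ> ?\<rho>))"
    define p where "p i = (if i < ?s then ?q i else i)" for i
    have D1: "bij_betw (inv_into D fst \<circ> ?\<rho>) {0..<?s} D"
      using bij(1) inj(1) by (intro bij_betw_trans[OF bij(1)] bij_betw_inv_into) (simp add: bij_betw_def)
    have "bij_betw ?q {0..<?s} {0..<?s}"
      using inj(2) bij(2) by (intro bij_betw_trans[OF bij_betw_trans[OF D1]] bij_betw_inv_into) (auto simp: bij_betw_def)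
    then have "bij_betw p {0..<?s} {0..<?s}" by (rule bij_betw_cong[THEN iffD1, rotated]) (simp add: p_def)
    then have "p \<in> P" unfolding P_def by (auto intro!: bij_imp_permutes simp: p_def)
    moreover have "mset_of (N p) = mset_set D"
    proof -
      have "(?\<rho> i, ?\<gamma> (p i)) = (inv_into D fst \<circ> ?\<rho>) i" if "i < ?s" for i
      proof -
        let ?v = "inv_into D fst (?\<rho> i)"
        have "?\<rho> i \<in> ?R" using bij(1) that by (auto simp: bij_betw_def)
        then have "?v \<in> D" "fst ?v = ?\<rho> i" by (auto intro: inv_into_into f_inv_into_f)
        moreover have "?\<gamma> (p i) = snd ?v"
          using \<open>?v \<in> D\<close> that bij(2) by (auto simp: p_def bij_betw_def intro!: f_inv_into_f)
        ultimately show ?thesis by (simp add: prod_eq_iff)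
      qed
      then have "mset_of (N p) = image_mset (inv_into D fst \<circ> ?\<rho>) (mset_set {0..<?s})"
        unfolding mset_N by (intro image_mset_cong) auto
      also have "\<dots> = mset_set D" using D1 by (simp add: bij_betw_def image_mset_mset_set)
      finally show ?thesis .
    qed
    ultimately show ?thesis by blast
  qed
  then obtain p0 where p0: "p0 \<in> P" "mset_of (N p0) = mset_set D" by blast
  have less: "weight (N p) < weight (N p0)" if p: "p \<in> P" "p \<noteq> p0" for p
  proof -
    have perm: "image_mset p (mset_set {0..<?s}) = mset_set {0..<?s}"
      using p(1) by (simp add: P_def image_mset_mset_set permutes_inj_on permutes_image)
    have "image_mset fst (mset_of (N p)) = mset_set ?R"
      using bij(1) unfolding mset_N by (simp add: multiset.map_comp o_def image_mset_mset_set bij_betw_def)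
    moreover have "image_mset snd (mset_of (N p)) = image_mset ?\<gamma> (image_mset p (mset_set {0..<?s}))"
      unfolding mset_N by (simp add: multiset.map_comp o_def)
    then have "image_mset snd (mset_of (N p)) = mset_set ?C"
      using bij(2) unfolding perm by (simp add: image_mset_mset_set bij_betw_def)
    ultimately have "mset_of (N p) = mset_set D \<or> (\<Sum>v\<in>#mset_of (N p). wt v) < (\<Sum>v\<in>#mset_set D. wt v)"
      by (rule antidiag_leading[OF D(1)])
    moreover have "mset_of (N p) \<noteq> mset_set D" using inj_N p p0 mset_of_eq_iff by metis
    ultimately show ?thesis by (simp add: weight_def p0(2))
  qed
  show ?thesis
  proof
    show "\<mu> \<in> minors ?s (?R \<times> ?C)" unfolding minors_def \<mu>_def
      using inj by (intro CollectI exI[of _ ?R] exI[of _ ?C]) (auto simp: card_image)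
    show "mset_of (N p0) = mset_set D" by fact
    show "signof p0 * signof p0 = (1 :: 'k)" by (simp add: sign_def)
    fix Q assume Q: "Q \<in> Poly_Mapping.keys (\<mu> - Poly_Mapping.single (N p0) (signof p0))"
    have "\<mu> - Poly_Mapping.single (N p0) (signof p0) = (\<Sum>p\<in>P - {p0}. Poly_Mapping.single (N p) (signof p))"
      unfolding \<mu> using p0 fin by (simp add: sum_diff1)
    then have "Q \<in> (\<Union>p\<in>P - {p0}. Poly_Mapping.keys (Poly_Mapping.single (N p) (signof p :: 'k)))"
      using Q Poly_Mapping.keys_sum[of "\<lambda>p. Poly_Mapping.single (N p) (signof p :: 'k)" "P - {p0}"] by auto
    then obtain p where p: "p \<in> P - {p0}" "Q \<in> Poly_Mapping.keys (Poly_Mapping.single (N p) (signof p :: 'k))"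
      by blast
    then have "Q = N p" by (simp split: if_splits)
    then show "weight Q < weight (N p0)" using less p(1) by simp
  qed
qed

section \<open>Reduction of leading terms\<close>

lemma polys_single: "Poly_Mapping.keys M \<subseteq> S \<Longrightarrow> Poly_Mapping.single M a \<in> polys S"
  by (simp add: polys_def)

lemma keys_single_mult:
  "Poly_Mapping.keys (Poly_Mapping.single M a * p) \<subseteq> (+) M ` Poly_Mapping.keys p"
  using Poly_Mapping.keys_mult[of "Poly_Mapping.single M a" p] by (auto split: if_splits)

text \<open>Division by leading terms. Several monomials can share the top weight, so all of these
  are removed at once; weights are nonnegative integers, so the process ends.\<close>

lemma leading_reduction:
  fixes f :: "'k::comm_ring_1 mpoly" and I :: "'k mpoly set"
  assumes I0: "0 \<in> I" and I_add: "\<And>x y. x \<in> I \<Longrightarrow> y \<in> I \<Longrightarrow> x + y \<in> I"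
    and V_minus: "\<And>x y. x \<in> V \<Longrightarrow> y \<in> I \<Longrightarrow> x - y \<in> V"
    and step: "\<And>f M. f \<in> V \<Longrightarrow> M \<in> Poly_Mapping.keys f \<Longrightarrow>
        (\<And>N. N \<in> Poly_Mapping.keys f \<Longrightarrow> weight N \<le> weight M) \<Longrightarrow>
        \<exists>h\<in>I. \<forall>N\<in>Poly_Mapping.keys (h - Poly_Mapping.single M (Poly_Mapping.lookup f M)). weight N < weight M"
    and "f \<in> V"
  shows "f \<in> I"
proof -
  have "f \<in> I" if "f \<in> V" "\<And>N. N \<in> Poly_Mapping.keys f \<Longrightarrow> weight N < int n" for f n
    using that
  proof (induction n arbitrary: f)
    case 0
    then have "Poly_Mapping.keys f = {}" using weight_nonneg by (metis equals0I linorder_not_less of_nat_0)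
    then show ?case using I0 by simp
  next
    case (Suc n)
    let ?T = "{M \<in> Poly_Mapping.keys f. weight M = int n}"
    let ?s = "\<lambda>M. Poly_Mapping.single M (Poly_Mapping.lookup f M)"
    have "weight N \<le> int n" if "N \<in> Poly_Mapping.keys f" for N
      using Suc.prems(2)[OF that] by simp
    then have "\<forall>M\<in>?T. \<exists>h\<in>I. \<forall>N\<in>Poly_Mapping.keys (h - ?s M). weight N < weight M"
      using Suc.prems(1) by (intro ballI step) auto
    then obtain h where h: "\<And>M. M \<in> ?T \<Longrightarrow> h M \<in> I"
      "\<And>M N. M \<in> ?T \<Longrightarrow> N \<in> Poly_Mapping.keys (h M - ?s M) \<Longrightarrow> weight N < int n"
      by (metis (mono_tags, lifting) mem_Collect_eq)
    define H where "H = sum h ?T"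
    have "sum h F \<in> I" if "\<And>M. M \<in> F \<Longrightarrow> h M \<in> I" for F
      using that by (induction F rule: infinite_finite_induct) (auto simp: I0 I_add)
    then have H: "H \<in> I" unfolding H_def using h(1) by blast
    have "f = (\<Sum>M\<in>Poly_Mapping.keys f. ?s M)" by (rule poly_mapping_sum_single)
    also have "\<dots> = sum ?s ?T + sum ?s (Poly_Mapping.keys f - ?T)"
      by (simp add: sum.subset_diff[of ?T "Poly_Mapping.keys f"] add.commute)
    finally have "f - H = sum ?s ?T + sum ?s (Poly_Mapping.keys f - ?T) - ((\<Sum>M\<in>?T. h M - ?s M) + sum ?s ?T)"
      by (rule arg_cong2[where f = "(-)"]) (simp add: H_def sum_subtractf)
    also have "\<dots> = sum ?s (Poly_Mapping.keys f - ?T) - (\<Sum>M\<in>?T. h M - ?s M)" by simp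
    finally have f: "f - H = sum ?s (Poly_Mapping.keys f - ?T) - (\<Sum>M\<in>?T. h M - ?s M)" .
    have "weight N < int n" if N: "N \<in> Poly_Mapping.keys (f - H)" for N
    proof -
      have "N \<in> Poly_Mapping.keys (sum ?s (Poly_Mapping.keys f - ?T)) \<or>
          N \<in> Poly_Mapping.keys (\<Sum>M\<in>?T. h M - ?s M)"
        using N unfolding f by (auto simp: in_keys_iff lookup_minus)
      then show ?thesis
      proof
        assume "N \<in> Poly_Mapping.keys (sum ?s (Poly_Mapping.keys f - ?T))"
        then have "N \<in> Poly_Mapping.keys f - ?T"
          using Poly_Mapping.keys_sum[of ?s "Poly_Mapping.keys f - ?T"] by (auto split: if_splits)
        then show ?thesis using Suc.prems(2)[of N] by auto
      next
        assume "N \<in> Poly_Mapping.keys (\<Sum>M\<in>?T. h M - ?s M)"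
        then show ?thesis
          using Poly_Mapping.keys_sum[of "\<lambda>M. h M - ?s M" ?T] h(2) by blast
      qed
    qed
    with V_minus[OF Suc.prems(1) H] have "f - H \<in> I" by (rule Suc.IH)
    then have "f - H + H \<in> I" using H by (rule I_add)
    then show ?case by simp
  qed
  moreover obtain n where "\<And>N. N \<in> Poly_Mapping.keys f \<Longrightarrow> weight N < int n"
  proof
    fix N assume "N \<in> Poly_Mapping.keys f"
    then have "weight N \<le> Max (weight ` Poly_Mapping.keys f)" by simp
    then show "weight N < int (nat (Max (weight ` Poly_Mapping.keys f) + 1))" by linarith
  qed
  ultimately show ?thesis using assms(5) by blast
qed

section \<open>Blocks attached to the corners\<close>

definition height :: "(nat \<times> nat) set \<Rightarrow> nat \<times> nat \<Rightarrow> nat" where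
  "height S v = Max (card ` {D. D \<subseteq> S \<and> antidiag D \<and> v \<in> D \<and> (\<forall>x\<in>D. fst x \<le> fst v)})"

lemma height_attained:
  assumes "finite S" "v \<in> S"
  obtains D where "D \<subseteq> S" "antidiag D" "v \<in> D" "\<And>x. x \<in> D \<Longrightarrow> fst x \<le> fst v" "card D = height S v"
proof -
  let ?A = "{D. D \<subseteq> S \<and> antidiag D \<and> v \<in> D \<and> (\<forall>x\<in>D. fst x \<le> fst v)}"
  have "finite ?A" by (rule finite_subset[of _ "Pow S"]) (use assms in auto)
  moreover have "{v} \<in> ?A" using assms by (auto simp: antidiag_def)
  ultimately have "height S v \<in> card ` ?A" unfolding height_def by (intro Max_in) auto
  then obtain D where "D \<in> ?A" "card D = height S v" by (metis (lifting) imageE)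
  then show ?thesis by (intro that[of D]) simp_all
qed

lemma card_le_height:
  assumes "finite S" "D \<subseteq> S" "antidiag D" "v \<in> D" "\<And>x. x \<in> D \<Longrightarrow> fst x \<le> fst v"
  shows "card D \<le> height S v"
  unfolding height_def
proof (rule Max_ge)
  show "finite (card ` {D. D \<subseteq> S \<and> antidiag D \<and> v \<in> D \<and> (\<forall>x\<in>D. fst x \<le> fst v)})"
    by (rule finite_imageI, rule finite_subset[of _ "Pow S"]) (use assms(1) in auto)
  show "card D \<in> card ` {D. D \<subseteq> S \<and> antidiag D \<and> v \<in> D \<and> (\<forall>x\<in>D. fst x \<le> fst v)}"
    by (intro imageI CollectI conjI ballI assms)
qed

text \<open>An antidiagonal whose lower left end is \<open>v\<close> can be extended by
  \<open>v'\<close>. Consequently positions of equal height form a weakly increasing chain.\<close>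

lemma height_less:
  assumes S: "finite S" "v \<in> S" "v' \<in> S" and less: "fst v < fst v'" "snd v' < snd v"
  shows "height S v < height S v'"
proof -
  obtain D where D: "D \<subseteq> S" "antidiag D" "v \<in> D" "\<And>x. x \<in> D \<Longrightarrow> fst x \<le> fst v" "card D = height S v"
    using height_attained[OF S(1,2)] by blast
  have x: "fst x < fst v' \<and> snd v' < snd x" if "x \<in> D" for x
  proof (cases "x = v")
    case False
    then have "fst x < fst v \<and> snd v < snd x"
      using D(2,3) D(4)[OF that] that unfolding antidiag_def by (metis leD)
    then show ?thesis using less by simp
  qed (use less in simp)
  have "card (insert v' D) \<le> height S v'"
  proof (rule card_le_height)
    show "antidiag (insert v' D)" using D(2) x unfolding antidiag_def by auto
    show "fst y \<le> fst v'" if "y \<in> insert v' D" for y using that x[of y] by (auto simp: less_imp_le)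
  qed (use S D in auto)
  moreover have "v' \<notin> D" "finite D" using x[of v'] S D(1) by (auto intro: finite_subset)
  ultimately show ?thesis using D(5) by simp
qed

lemma height_bounds:
  assumes "finite S" "v \<in> S"
  shows "1 \<le> height S v" "height S v \<le> card S"
proof -
  obtain D where D: "D \<subseteq> S" "antidiag D" "v \<in> D" "\<And>x. x \<in> D \<Longrightarrow> fst x \<le> fst v" "card D = height S v"
    using height_attained[OF assms] by blast
  then have "finite D" using assms by (auto intro: finite_subset)
  then have "1 \<le> card D" using D(3) by (auto simp: Suc_le_eq card_gt_0_iff)
  moreover have "card D \<le> card S" using D(1) assms(1) by (rule card_mono[rotated])
  ultimately show "1 \<le> height S v" "height S v \<le> card S" using D(5) by simp_all
qed

lemma antidiag_subset: "antidiag D \<Longrightarrow> D' \<subseteq> D \<Longrightarrow> antidiag D'"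
  unfolding antidiag_def by blast

lemma antidiag_snd_le:
  assumes "antidiag D" "v \<in> D" "x \<in> D" "fst x \<le> fst v"
  shows "snd v \<le> snd x"
proof (cases "x = v")
  case False
  then have "fst x < fst v \<and> snd v < snd x \<or> fst v < fst x \<and> snd x < snd v"
    using assms(1-3) unfolding antidiag_def by blast
  then show ?thesis using assms(4) by auto
qed simp

text \<open>All elements lie weakly above and to the right of \<open>v\<close>, hence in every
  corner region that contains \<open>v\<close>.\<close>

lemma antidiag_of_height:
  assumes S: "finite S" "v \<in> S" and s: "s \<le> height S v"
  obtains D where "D \<subseteq> S" "antidiag D" "card D = s" "\<And>x. x \<in> D \<Longrightarrow> fst x \<le> fst v \<and> snd v \<le> snd x"
proof -
  obtain D where D: "D \<subseteq> S" "antidiag D" "v \<in> D" "\<And>x. x \<in> D \<Longrightarrow> fst x \<le> fst v" "card D = height S v"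
    using height_attained[OF S] by blast
  obtain D' where D': "D' \<subseteq> D" "card D' = s" using s D(5) by (metis obtain_subset_with_card_n)
  show ?thesis
  proof
    show "D' \<subseteq> S" using D(1) D'(1) by blast
    show "antidiag D'" using D(2) D'(1) by (rule antidiag_subset)
    show "card D' = s" by fact
    fix x assume "x \<in> D'"
    then have x: "x \<in> D" using D' by blast
    then show "fst x \<le> fst v \<and> snd v \<le> snd x"
      using antidiag_snd_le[OF D(2,3) x] D(4)[OF x] by simp
  qed
qed

text \<open>\<open>H\<close> bounds the levels, which keeps the set of blocks finite; it has to
  reach the largest height that occurs.\<close>

locale corner_sequence =
  fixes k :: nat and d c t :: "nat \<Rightarrow> nat" and H :: nat
  assumes mono_d: "mono_on {1..k} d" and mono_c: "mono_on {1..k} c"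
    and t_pos: "\<And>j. j \<in> {1..k} \<Longrightarrow> 1 \<le> t j"
begin

text \<open>
  Level \<open>l\<close> has to vanish on the corner regions \<open>{(r, q). r \<le> d j \<and> c j \<le> q}\<close> with \<open>t j \<le> l\<close>.  The
  complement of these regions is a union of rectangles \<open>r > d i\<close>, \<open>q < c i'\<close> with \<open>i < i'\<close>
  consecutive elements of \<open>J l\<close>; \<open>(l, i)\<close> names the block supported on it.  The start \<open>i = 0\<close> stands
  for no condition on the row.
\<close>

definition J :: "nat \<Rightarrow> nat set" where
  "J l = {j \<in> {1..k}. t j \<le> l}"

definition row_ok :: "nat \<Rightarrow> nat \<Rightarrow> nat \<Rightarrow> bool" where
  "row_ok l i r \<longleftrightarrow> i = 0 \<or> i \<in> J l \<and> d i < r"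

definition col_ok :: "nat \<Rightarrow> nat \<Rightarrow> nat \<Rightarrow> bool" where
  "col_ok l i q \<longleftrightarrow> (\<forall>j\<in>J l. i < j \<longrightarrow> q < c j)"

definition blocks :: "nat \<times> nat \<Rightarrow> (nat \<times> nat) set" where
  "blocks v = {(l, i). l \<in> {1..H} \<and> i \<le> k \<and> row_ok l i (fst v) \<and> col_ok l i (snd v)}"

lemma finite_blocks: "finite (blocks v)"
  by (rule finite_subset[of _ "{1..H} \<times> {..k}"]) (auto simp: blocks_def)

lemma finite_J: "finite (J l)"
  by (simp add: J_def)

text \<open>The predecessor of \<open>j\<close> in \<open>J l\<close>, or 0: the only block of level
  \<open>l\<close> that can meet the corner region of \<open>j\<close>.\<close>

definition active :: "nat \<Rightarrow> nat \<Rightarrow> nat" where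
  "active j l = Max (insert 0 {i \<in> J l. i < j})"

text \<open>In the region of \<open>j\<close>, a block \<open>(l, i)\<close> covering
  \<open>v\<close> has \<open>i < j\<close> by its row condition, and every later element of
  \<open>J l\<close> exceeds \<open>j\<close> by its column condition. So
  \<open>j \<notin> J l\<close>, that is \<open>l < t j\<close>, and \<open>i\<close> is determined
  by \<open>l\<close>: fewer than \<open>t j\<close> blocks meet the region.\<close>

lemma blocks_region:
  assumes j: "j \<in> {1..k}" and v: "fst v \<le> d j" "c j \<le> snd v"
  shows "blocks v = {(l, i). l \<in> {1..<t j} \<and> l \<le> H \<and> i = active j l \<and> row_ok l i (fst v) \<and> col_ok l i (snd v)}"
proof -
  have act: "active j l \<le> k" for l
    unfolding active_def using finite_J by (subst Max_le_iff) (auto simp: J_def)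
  have "l < t j \<and> i = active j l" if il: "row_ok l i (fst v)" "col_ok l i (snd v)" for l i
  proof -
    have "i < j"
    proof (cases "i = 0")
      case False
      then have i: "i \<in> {1..k}" "d i < d j" using il(1) v(1) by (auto simp: row_ok_def J_def)
      show ?thesis using mono_onD[OF mono_d j i(1)] i(2) by (meson leD not_le)
    qed (use j in simp)
    moreover have gt: "j < j'" if "j' \<in> J l" "i < j'" for j'
    proof -
      have "c j < c j'" using il(2) that v(2) by (auto simp: col_ok_def)
      moreover have "j' \<in> {1..k}" using that by (simp add: J_def)
      ultimately show ?thesis using mono_onD[OF mono_c _ j, of j'] by (meson leD not_le)
    qed
    ultimately have "j \<notin> J l" by blast
    moreover have "active j l = i" unfolding active_def
    proof (rule Max_eqI)
      show "i' \<le> i" if "i' \<in> insert 0 {i \<in> J l. i < j}" for i' using that gt by force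
      show "i \<in> insert 0 {i \<in> J l. i < j}" using il(1) \<open>i < j\<close> by (auto simp: row_ok_def)
    qed (simp add: finite_J)
    ultimately show ?thesis using j by (auto simp: J_def)
  qed
  then show ?thesis using act unfolding blocks_def by auto
qed

text \<open>The covering condition of a block splits into one on the row and one on the column, so
  on the region the matrix becomes a sum of \<open>t j - 1\<close> products
  \<open>y l r * z l q\<close>, some of them possibly zero.\<close>

lemma minors_vanish:
  assumes j: "j \<in> {1..k}" and S: "\<And>v. v \<in> S \<Longrightarrow> fst v \<le> d j \<and> c j \<le> snd v"
    and \<mu>: "\<mu> \<in> (minors (t j) S :: 'k::comm_ring_1 mpoly set)"
  shows "subst (rank_one_sum blocks) \<mu> = 0"
proof -
  interpret comm_ring_hom "subst (rank_one_sum blocks) :: 'k mpoly \<Rightarrow> _" by (rule comm_ring_hom_subst)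
  obtain R C where RC: "card R = t j" "card C = t j" "R \<times> C \<subseteq> S"
    and \<mu>: "\<mu> = det (mat (t j) (t j) (\<lambda>(i, j). var (sorted_list_of_set R ! i, sorted_list_of_set C ! j)))"
    using \<mu> unfolding minors_def by blast
  have "finite R" "finite C" using RC t_pos[OF j] by (auto intro: card_ge_0_finite)
  then have nth: "sorted_list_of_set R ! i \<in> R" "sorted_list_of_set C ! i \<in> C" if "i < t j" for i
    using that RC nth_mem[of i "sorted_list_of_set R"] nth_mem[of i "sorted_list_of_set C"] by auto
  define y :: "nat \<Rightarrow> nat \<Rightarrow> nat multiset \<Rightarrow>\<^sub>0 'k" where
    "y l r = (if l \<le> H \<and> row_ok l (active j l) r
      then Poly_Mapping.single {#to_nat ((l, active j l), False, r)#} 1 else 0)" for l r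
  define z :: "nat \<Rightarrow> nat \<Rightarrow> nat multiset \<Rightarrow>\<^sub>0 'k" where
    "z l q = (if col_ok l (active j l) q
      then Poly_Mapping.single {#to_nat ((l, active j l), True, q)#} 1 else 0)" for l q
  have entry: "rank_one_sum blocks (r, q) = (\<Sum>l\<in>{1..<t j}. y l r * z l q)" if "(r, q) \<in> S" for r q
  proof -
    let ?L = "{l \<in> {1..<t j}. l \<le> H \<and> row_ok l (active j l) r \<and> col_ok l (active j l) q}"
    have "blocks (r, q) = (\<lambda>l. (l, active j l)) ` ?L"
      using S[OF that] j by (subst blocks_region[of j]) auto
    then have "rank_one_sum blocks (r, q) = (\<Sum>l\<in>?L. Poly_Mapping.single (cell (l, active j l) (r, q)) (1 :: 'k))"
      unfolding rank_one_sum_def by (simp add: sum.reindex inj_on_def)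
    also have "\<dots> = (\<Sum>l\<in>{1..<t j}. y l r * z l q)"
      by (intro sum.mono_neutral_cong_left) (auto simp: y_def z_def mult_single cell_def add_mset_commute)
    finally show ?thesis .
  qed
  have entry': "rank_one_sum blocks (sorted_list_of_set R ! i, sorted_list_of_set C ! i') =
      (\<Sum>l\<in>{1..<t j}. y l (sorted_list_of_set R ! i) * z l (sorted_list_of_set C ! i'))"
    if "i < t j" "i' < t j" for i i'
    using nth that RC(3) by (intro entry) blast
  have "subst (rank_one_sum blocks) \<mu> = det (map_mat (subst (rank_one_sum blocks))
      (mat (t j) (t j) (\<lambda>(i, j). var (sorted_list_of_set R ! i, sorted_list_of_set C ! j) :: 'k mpoly)))"
    unfolding \<mu> by simp
  also have "map_mat (subst (rank_one_sum blocks))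
      (mat (t j) (t j) (\<lambda>(i, j). var (sorted_list_of_set R ! i, sorted_list_of_set C ! j) :: 'k mpoly)) =
    mat (t j) (t j) (\<lambda>(i, i'). \<Sum>l\<in>{1..<t j}. y l (sorted_list_of_set R ! i) * z l (sorted_list_of_set C ! i'))"
    by (rule eq_matI) (simp_all add: entry')
  also have "det \<dots> = 0"
    using t_pos[OF j] by (rule det_sum_rank_one_eq_0[where y = "\<lambda>l i. y l (sorted_list_of_set R ! i)"
        and z = "\<lambda>l i. z l (sorted_list_of_set C ! i)"])
  finally show ?thesis .
qed

text \<open>Without such an antidiagonal, \<open>lay\<close> would assign to each position of the
  support a block covering it. Then \<open>layered_not_leading\<close> yields two positions of equal
  height in antidiagonal position, against \<open>height_less\<close>.\<close>

lemma leading_monomial_antidiag: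
  fixes f :: "'k::comm_ring_1 mpoly"
  assumes f: "subst (rank_one_sum blocks) f = 0" and M: "M \<in> Poly_Mapping.keys f"
    and max: "\<And>N. N \<in> Poly_Mapping.keys f \<Longrightarrow> weight N \<le> weight M"
    and H: "card (Poly_Mapping.keys M) \<le> H"
  obtains j D where "j \<in> {1..k}" "D \<subseteq> Poly_Mapping.keys M" "antidiag D" "card D = t j"
    "\<And>x. x \<in> D \<Longrightarrow> fst x \<le> d j \<and> c j \<le> snd x"
proof (rule ccontr)
  note found = that
  assume no: "\<not> thesis"
  let ?S = "Poly_Mapping.keys M"
  \<comment> \<open>The level is the height; within it, the block starts at the last index whose
    corner row lies above \<open>v\<close>, or at 0.\<close>
  define lay where "lay v = (height ?S v, Max (insert 0 {i \<in> J (height ?S v). d i < fst v}))" for v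
  \<comment> \<open>A longer antidiagonal ending at \<open>v\<close> would contain one of length
    \<open>t j\<close> inside the region of \<open>j\<close>.\<close>
  have low: "height ?S v < t j" if v: "v \<in> ?S" "fst v \<le> d j" "c j \<le> snd v" and j: "j \<in> {1..k}" for v j
  proof (rule ccontr)
    assume "\<not> height ?S v < t j"
    then have "t j \<le> height ?S v" by simp
    then obtain D where "D \<subseteq> ?S" "antidiag D" "card D = t j" "\<And>x. x \<in> D \<Longrightarrow> fst x \<le> fst v \<and> snd v \<le> snd x"
      using antidiag_of_height[OF finite_keys v(1)] by blast
    then have thesis using j v(2,3) by (intro found[of j D]) (auto intro: order_trans)
    then show False using no by simp
  qed
  have "\<exists>v\<in>?S. \<exists>v'\<in>?S. lay v = lay v' \<and> fst v < fst v' \<and> snd v' < snd v"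
  proof (rule layered_not_leading[OF finite_blocks f M])
    show "(\<Sum>v\<in>#mset_of N. wt v) \<le> (\<Sum>v\<in>#mset_of M. wt v)" if "N \<in> Poly_Mapping.keys f" for N
      using max[OF that] by (simp add: weight_def)
    fix v assume v: "v \<in> ?S"
    let ?l = "height ?S v"
    let ?I = "insert 0 {i \<in> J ?l. d i < fst v}"
    have fin: "finite ?I" using finite_J by simp
    then have "Max ?I \<in> ?I" by (intro Max_in) auto
    moreover have "snd v < c j" if j: "j \<in> J ?l" "Max ?I < j" for j
    proof (rule ccontr)
      assume "\<not> snd v < c j"
      moreover have "j \<notin> ?I" using Max_ge[OF fin, of j] j(2) by auto
      then have "fst v \<le> d j" using j(1) by auto
      ultimately have "?l < t j" using low[OF v] j(1) by (simp add: J_def)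
      then show False using j(1) by (simp add: J_def)
    qed
    ultimately show "lay v \<in> blocks v"
      using height_bounds[of ?S v] v H by (auto simp: blocks_def lay_def row_ok_def col_ok_def J_def)
  qed
  then show False using height_less[of ?S] by (fastforce simp: lay_def)
qed

end

section \<open>Ideals and ladders\<close>

lemma ideal_poly_ringI:
  assumes "I \<subseteq> polys U" "0 \<in> I" "\<And>x y. x \<in> I \<Longrightarrow> y \<in> I \<Longrightarrow> x + y \<in> I"
    and mult: "\<And>p x. p \<in> polys U \<Longrightarrow> x \<in> I \<Longrightarrow> p * x \<in> I"
  shows "ideal I (poly_ring U :: 'k::comm_ring_1 mpoly ring)"
proof -
  interpret R: cring "poly_ring U :: 'k mpoly ring" by (rule cring_poly_ring)
  have neg: "\<ominus>\<^bsub>poly_ring U\<^esub> x = - x" if "x \<in> I" for x :: "'k mpoly"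
    using that assms(1) by (intro R.minus_equality) (auto simp: poly_ring_def polys_closed)
  have "- x \<in> I" if "x \<in> I" for x
    using mult[of "- 1" x] that by (simp add: polys_closed)
  then have "subgroup I (add_monoid (poly_ring U))"
    using assms(1-3) neg by unfold_locales (auto simp: poly_ring_def a_inv_def)
  moreover have "x * p \<in> I" if "p \<in> polys U" "x \<in> I" for p x
    using mult[OF that] by (simp add: mult.commute)
  ultimately show ?thesis
    using mult by (intro idealI R.ring_axioms) (auto simp: poly_ring_def)
qed

lemma ideal_poly_ringD:
  assumes "ideal I (poly_ring U :: 'k::comm_ring_1 mpoly ring)"
  shows "I \<subseteq> polys U" "0 \<in> I" "\<And>x y. x \<in> I \<Longrightarrow> y \<in> I \<Longrightarrow> x + y \<in> I"
    "\<And>p x. p \<in> polys U \<Longrightarrow> x \<in> I \<Longrightarrow> p * x \<in> I"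
proof -
  interpret ideal I "poly_ring U :: 'k mpoly ring" by fact
  show "I \<subseteq> polys U" using a_subset by (simp add: poly_ring_def)
  show "0 \<in> I" using additive_subgroup.zero_closed[OF is_additive_subgroup] by (simp add: poly_ring_def)
  show "x + y \<in> I" if "x \<in> I" "y \<in> I" for x y using additive_subgroup.a_closed[OF is_additive_subgroup that] by (simp add: poly_ring_def)
  show "p * x \<in> I" if "p \<in> polys U" "x \<in> I" for p x
    using I_l_closed[of x p] that by (simp add: poly_ring_def)
qed

lemma ideal_det_ideal: "S \<subseteq> U \<Longrightarrow> 1 \<le> s \<Longrightarrow> ideal (det_ideal U s S :: 'k::comm_ring_1 mpoly set) (poly_ring U)"
  unfolding det_ideal_def
  by (intro ring.genideal_ideal minors_subset cring.axioms(1) cring_poly_ring)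

lemma minors_in_det_ideal: "S \<subseteq> U \<Longrightarrow> 1 \<le> s \<Longrightarrow> minors s S \<subseteq> (det_ideal U s S :: 'k::comm_ring_1 mpoly set)"
  unfolding det_ideal_def
  by (intro ring.genideal_self minors_subset cring.axioms(1) cring_poly_ring)

lemma det_ideal_subset:
  "ideal I (poly_ring U) \<Longrightarrow> minors s S \<subseteq> I \<Longrightarrow> det_ideal U s S \<subseteq> (I :: 'k::comm_ring_1 mpoly set)"
  unfolding det_ideal_def by (intro ring.genideal_minimal cring.axioms(1) cring_poly_ring)

lemma minors_mono: "S \<subseteq> S' \<Longrightarrow> minors s S \<subseteq> minors s S'"
  unfolding minors_def by blast

lemma ideal_kernel:
  fixes \<phi> :: "'k::comm_ring_1 mpoly \<Rightarrow> 'b::comm_ring_1"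
  assumes "comm_ring_hom \<phi>"
  shows "ideal {f \<in> polys U. \<phi> f = 0} (poly_ring U)"
proof -
  interpret comm_ring_hom \<phi> by fact
  show ?thesis by (rule ideal_poly_ringI) (auto simp: polys_closed hom_distribs)
qed

lemma primeideal_kernel:
  fixes \<phi> :: "'k::comm_ring_1 mpoly \<Rightarrow> 'b::idom"
  assumes "comm_ring_hom \<phi>"
  shows "primeideal {f \<in> polys U. \<phi> f = 0} (poly_ring U)"
proof -
  interpret comm_ring_hom \<phi> by fact
  have "1 \<in> carrier (poly_ring U :: 'k mpoly ring)" by (simp add: poly_ring_def polys_closed)
  moreover have "1 \<notin> {f \<in> polys U. \<phi> f = 0}" by simp
  ultimately have "carrier (poly_ring U) \<noteq> {f \<in> polys U. \<phi> f = 0}" by blast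
  then show ?thesis
    using ideal_kernel[OF assms, of U] cring_poly_ring
    by (intro primeideal.intro primeideal_axioms.intro) (auto simp: poly_ring_def hom_distribs)
qed

text \<open>The contraction of the larger ideal to \<open>polys U\<close> is an ideal containing the
  generators of the smaller one.\<close>

lemma det_ideal_mono:
  assumes "S \<subseteq> S'" "U \<subseteq> U'" "S \<subseteq> U" "S' \<subseteq> U'" "1 \<le> s"
  shows "(det_ideal U s S :: 'k::comm_ring_1 mpoly set) \<subseteq> det_ideal U' s S'"
proof -
  let ?I = "det_ideal U' s S' :: 'k mpoly set"
  note I = ideal_poly_ringD[OF ideal_det_ideal[OF assms(4,5), where ?'k = 'k]]
  have "polys U \<subseteq> (polys U' :: 'k mpoly set)" using assms(2) by (fastforce simp: polys_def)
  then have "ideal (?I \<inter> polys U) (poly_ring U)"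
    using I by (intro ideal_poly_ringI) (auto simp: polys_closed)
  moreover have "minors s S \<subseteq> ?I \<inter> polys U"
    using minors_mono[OF assms(1)] minors_in_det_ideal[OF assms(4,5)] minors_subset[OF assms(3,5)]
    by (fastforce simp: poly_ring_def)
  ultimately show ?thesis using det_ideal_subset by blast
qed

lemma mixed_det_ideal_closed:
  assumes t: "\<forall>j\<in>{1..k}. 1 \<le> t j"
  shows "0 \<in> (mixed_det_ideal k t Y :: 'k::comm_ring_1 mpoly set)"
    and "x \<in> (mixed_det_ideal k t Y :: 'k mpoly set) \<Longrightarrow> y \<in> mixed_det_ideal k t Y \<Longrightarrow> x + y \<in> mixed_det_ideal k t Y"
    and "j \<in> {1..k} \<Longrightarrow> z \<in> (det_ideal (\<Union>i\<in>{1..k}. Y i) (t j) (Y j) :: 'k mpoly set) \<Longrightarrow> z \<in> mixed_det_ideal k t Y"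
proof -
  let ?d = "\<lambda>j. det_ideal (\<Union>i\<in>{1..k}. Y i) (t j) (Y j) :: 'k mpoly set"
  have "ideal (?d j) (poly_ring (\<Union>i\<in>{1..k}. Y i))" if "j \<in> {1..k}" for j
    using t that by (intro ideal_det_ideal) auto
  note d = ideal_poly_ringD[OF this]
  show "0 \<in> (mixed_det_ideal k t Y :: 'k mpoly set)"
    unfolding mixed_det_ideal_def using d(2) by (intro CollectI exI[of _ "\<lambda>_. 0"]) auto
  show "x + y \<in> mixed_det_ideal k t Y"
    if x: "x \<in> (mixed_det_ideal k t Y :: 'k mpoly set)" and y: "y \<in> mixed_det_ideal k t Y"
  proof -
    obtain f g where "x = (\<Sum>j=1..k. f j)" "y = (\<Sum>j=1..k. g j)" "\<forall>j\<in>{1..k}. f j \<in> ?d j" "\<forall>j\<in>{1..k}. g j \<in> ?d j"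
      using x y unfolding mixed_det_ideal_def by blast
    then show ?thesis unfolding mixed_det_ideal_def
      using d(3) by (intro CollectI exI[of _ "\<lambda>j. f j + g j"]) (auto simp: sum.distrib)
  qed
  show "z \<in> mixed_det_ideal k t Y" if "j \<in> {1..k}" "z \<in> ?d j"
    unfolding mixed_det_ideal_def using d(2) that
    by (intro CollectI exI[of _ "\<lambda>i. if i = j then z else 0"]) (auto simp: sum.delta)
qed

lemma mixed_det_ideal_subset_kernel:
  fixes \<phi> :: "'k::comm_ring_1 mpoly \<Rightarrow> 'b::comm_ring_1"
  assumes \<phi>: "comm_ring_hom \<phi>" and t: "\<forall>j\<in>{1..k}. 1 \<le> t j"
    and "\<And>j \<mu>. j \<in> {1..k} \<Longrightarrow> \<mu> \<in> minors (t j) (Y j) \<Longrightarrow> \<phi> \<mu> = 0"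
  shows "mixed_det_ideal k t Y \<subseteq> {f \<in> polys (\<Union>i\<in>{1..k}. Y i). \<phi> f = 0}"
proof
  let ?U = "\<Union>i\<in>{1..k}. Y i"
  interpret comm_ring_hom \<phi> by fact
  fix x :: "'k mpoly" assume "x \<in> mixed_det_ideal k t Y"
  then obtain f where x: "x = (\<Sum>j=1..k. f j)" and f: "\<forall>j\<in>{1..k}. f j \<in> det_ideal ?U (t j) (Y j)"
    unfolding mixed_det_ideal_def by blast
  have "det_ideal ?U (t j) (Y j) \<subseteq> {f \<in> polys ?U. \<phi> f = 0}" if j: "j \<in> {1..k}" for j
  proof (rule det_ideal_subset[OF ideal_kernel[OF \<phi>]])
    have "minors (t j) (Y j) \<subseteq> carrier (poly_ring ?U :: 'k mpoly ring)"
      using t j by (intro minors_subset) auto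
    then have "minors (t j) (Y j) \<subseteq> (polys ?U :: 'k mpoly set)" by (simp add: poly_ring_def)
    then show "minors (t j) (Y j) \<subseteq> {f \<in> polys ?U. \<phi> f = 0}" using assms(3)[OF j] by blast
  qed
  then have f: "\<forall>j\<in>{1..k}. f j \<in> {f \<in> polys ?U. \<phi> f = 0}" using f by blast
  have "sum f F \<in> {f \<in> polys ?U. \<phi> f = 0}" if "F \<subseteq> {1..k}" for F
    using that f by (induction F rule: infinite_finite_induct) (auto simp: polys_closed hom_distribs)
  then show "x \<in> {f \<in> polys ?U. \<phi> f = 0}" unfolding x by blast
qed

text \<open>For the row of \<open>x\<close> and the column of \<open>y\<close>, whichever of
  \<open>x\<close> and \<open>y\<close> lies higher and further right supplies an upper corner that
  works for the mixed position. The lower corner bounds rows and columns separately.\<close>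

lemma antidiag_rectangle_in_subladder:
  assumes "j \<in> {1..k}" "antidiag D" "D \<subseteq> subladder h b a k d c j"
  shows "fst ` D \<times> snd ` D \<subseteq> subladder h b a k d c j"
proof
  fix v assume "v \<in> fst ` D \<times> snd ` D"
  then obtain x y where xy: "x \<in> D" "y \<in> D" and v: "v = (fst x, snd y)" by auto
  have mem: "\<exists>i\<in>{1..h}. b i \<le> fst x \<and> fst x \<le> d j \<and> c j \<le> snd x \<and> snd x \<le> a i" if "x \<in> D" for x
    using subsetD[OF assms(3) that] unfolding subladder_eq[OF assms(1)] by auto
  obtain i where i: "i \<in> {1..h}" "b i \<le> fst x" "fst x \<le> d j" "c j \<le> snd x" "snd x \<le> a i"
    using mem[OF xy(1)] by blast
  obtain i' where i': "i' \<in> {1..h}" "b i' \<le> fst y" "fst y \<le> d j" "c j \<le> snd y" "snd y \<le> a i'"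
    using mem[OF xy(2)] by blast
  have "fst x \<le> fst y \<and> snd y \<le> snd x \<or> fst y \<le> fst x \<and> snd x \<le> snd y"
    using assms(2) xy unfolding antidiag_def by (cases "x = y") (auto intro: less_imp_le)
  then have "\<exists>i\<in>{1..h}. b i \<le> fst x \<and> snd y \<le> a i" using i i' by (meson order_trans)
  then show "v \<in> subladder h b a k d c j"
    unfolding subladder_eq[OF assms(1)] v using i i' by auto
qed

theorem theorem1p18:
  fixes m n h k :: nat and b a d c t :: "nat \<Rightarrow> nat"
    and L :: "(nat \<times> nat) set" and Lj Xj :: "nat \<Rightarrow> (nat \<times> nat) set"
  assumes "m \<le> n"
    and "ladder_corners m n h b a k d c"
    and "\<forall>j\<in>{1..k}. 1 \<le> t j"
    and "L = ladder h b a k d c"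
    and "\<forall>j. Lj j = subladder h b a k d c j"
    and "\<forall>j. Xj j = smallest_submatrix m n (Lj j)"
    and "\<forall>x\<in>L. \<exists>j\<in>{1..k}. \<exists>R C. card R = t j \<and> card C = t j \<and> R \<times> C \<subseteq> Lj j \<and> x \<in> R \<times> C"
    and "\<forall>i\<in>{1..k}. \<forall>j\<in>{1..k}. i \<noteq> j \<longrightarrow>
           \<not> (det_ideal L (t i) (Lj i) :: 'k::alg_closed_field mpoly set) \<subseteq> det_ideal L (t j) (Lj j)"
  shows "(mixed_det_ideal k t Xj :: 'k mpoly set) \<inter> polys L = mixed_det_ideal k t Lj
    \<and> primeideal (mixed_det_ideal k t Lj :: 'k mpoly set) (poly_ring L)"
proof -
  note t = assms(3)
  have L_sub: "L \<subseteq> {1..m} \<times> {1..n}" using ladder_subset[OF assms(2)] assms(4) by simp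
  then have fin: "finite L" by (rule finite_subset) simp
  have L: "(\<Union>j\<in>{1..k}. Lj j) = L" using UN_subladder[of h b a k d c] assms(4,5) by simp
  \<comment> \<open>Heights in the support of a monomial of \<open>K[L]\<close> never exceed
    \<open>card L\<close>.\<close>
  interpret corner_sequence k d c t "card L"
    using assms(2,3) by unfold_locales (auto simp: ladder_corners_def)
  let ?\<phi> = "subst (rank_one_sum blocks) :: 'k mpoly \<Rightarrow> nat multiset \<Rightarrow>\<^sub>0 'k"
  interpret \<phi>: comm_ring_hom ?\<phi> by (rule comm_ring_hom_subst)
  have Lj: "v \<in> Lj j \<longleftrightarrow> v \<in> L \<and> fst v \<le> d j \<and> c j \<le> snd v" for v j
    using assms(4,5) by (auto simp: subladder_def)
  \<comment> \<open>The corner region is a product of a set of rows and a set of columns, so it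
    contains \<open>Xj j\<close> along with \<open>Lj j\<close>.\<close>
  have Lj_Xj: "Lj j \<subseteq> Xj j" and Xj: "\<And>v. v \<in> Xj j \<Longrightarrow> fst v \<le> d j \<and> c j \<le> snd v" for j
  proof -
    have "Xj j = fst ` Lj j \<times> snd ` Lj j"
      using smallest_submatrix_eq[of "Lj j"] Lj L_sub assms(6) by (metis subset_eq)
    then show "Lj j \<subseteq> Xj j" "\<And>v. v \<in> Xj j \<Longrightarrow> fst v \<le> d j \<and> c j \<le> snd v"
      using Lj by (auto simp: image_iff subset_eq) force+
  qed
  let ?I = "mixed_det_ideal k t Lj :: 'k mpoly set" and ?K = "{f \<in> polys L. ?\<phi> f = 0}"
  have I_sub: "?I \<subseteq> ?K"
    using mixed_det_ideal_subset_kernel[OF \<phi>.comm_ring_hom_axioms t, of Lj] minors_vanish Lj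
    unfolding L by blast
  have "?K \<subseteq> ?I"
  proof
    fix f assume f: "f \<in> ?K"
    show "f \<in> ?I"
    proof (rule leading_reduction[where V = ?K, OF mixed_det_ideal_closed(1,2)[OF t] _ _ f])
      show "x - y \<in> ?K" if "x \<in> ?K" "y \<in> ?I" for x y
        using that I_sub polys_closed(3)[of x L "- y"] polys_closed(5)[of y L]
        by (auto simp: \<phi>.hom_minus)
    next
      fix f M assume f: "f \<in> ?K" and M: "M \<in> Poly_Mapping.keys f"
        and max: "\<And>N. N \<in> Poly_Mapping.keys f \<Longrightarrow> weight N \<le> weight M"
      have M_L: "Poly_Mapping.keys M \<subseteq> L" using f M by (auto simp: polys_def)
      obtain j D where j: "j \<in> {1..k}" and D: "D \<subseteq> Poly_Mapping.keys M" "antidiag D" "card D = t j"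
        "\<And>x. x \<in> D \<Longrightarrow> fst x \<le> d j \<and> c j \<le> snd x"
        using leading_monomial_antidiag[of f M] f M max card_mono[OF fin M_L] by blast
      have finD: "finite D" using D(1) by (rule finite_subset) simp
      have "D \<subseteq> Lj j" using D(1,4) M_L Lj by blast
      then have rect: "fst ` D \<times> snd ` D \<subseteq> Lj j"
        using antidiag_rectangle_in_subladder[OF j D(2)] assms(5) by simp
      obtain N \<mu> and \<epsilon> :: 'k where \<mu>: "\<mu> \<in> minors (card D) (fst ` D \<times> snd ` D)"
        and N: "mset_of N = mset_set D" and \<epsilon>: "\<epsilon> * \<epsilon> = 1"
        and low: "\<And>Q. Q \<in> Poly_Mapping.keys (\<mu> - Poly_Mapping.single N \<epsilon>) \<Longrightarrow> weight Q < weight N"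
        by (rule antidiag_minor[OF D(2) finD, where ?'k = 'k]) (rule that)
      \<comment> \<open>The cofactor: \<open>D\<close> lies in the support of \<open>M\<close>, so
        the squarefree monomial of \<open>D\<close> divides \<open>M\<close>.\<close>
      obtain Q where Q: "mset_of Q = mset_of M - mset_set D" using mset_of_surj by blast
      have "mset_set D \<subseteq># mset_of M"
        using D(1) by (auto simp: subseteq_mset_def count_mset_set' in_keys_iff Suc_le_eq)
      then have "mset_of (Q + N) = mset_of M" using Q N by simp
      then have QN: "M = Q + N" by (simp only: mset_of_eq_iff)
      \<comment> \<open>As \<open>\<epsilon> * \<epsilon> = 1\<close>, the heaviest term of
        \<open>?p * \<mu>\<close> is exactly the term of \<open>f\<close> at
        \<open>M\<close>.\<close>
      let ?p = "Poly_Mapping.single Q (Poly_Mapping.lookup f M * \<epsilon>) :: 'k mpoly"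
      have "?p \<in> polys L" using M_L by (intro polys_single) (auto simp: Q simp flip: set_mset_mset_of dest: in_diffD)
      moreover have sub: "Lj j \<subseteq> L" "1 \<le> t j" using Lj t j by auto
      moreover have "\<mu> \<in> det_ideal L (t j) (Lj j)"
        using \<mu> minors_mono[OF rect] D(3) minors_in_det_ideal[OF sub] by auto
      ultimately have "?p * \<mu> \<in> det_ideal L (t j) (Lj j)"
        by (intro ideal_poly_ringD(4)[OF ideal_det_ideal])
      then have "?p * \<mu> \<in> ?I" using mixed_det_ideal_closed(3)[OF t j, of _ Lj] unfolding L by blast
      moreover have "weight Q' < weight M"
        if "Q' \<in> Poly_Mapping.keys (?p * \<mu> - Poly_Mapping.single M (Poly_Mapping.lookup f M))" for Q'
      proof -
        have "Poly_Mapping.single M (Poly_Mapping.lookup f M) = ?p * Poly_Mapping.single N \<epsilon>"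
          using \<epsilon> by (simp add: QN mult_single mult.assoc)
        then have "?p * \<mu> - Poly_Mapping.single M (Poly_Mapping.lookup f M) = ?p * (\<mu> - Poly_Mapping.single N \<epsilon>)"
          by (simp add: right_diff_distrib)
        then show ?thesis using that keys_single_mult low by (fastforce simp: QN weight_add)
      qed
      ultimately show "\<exists>h\<in>?I. \<forall>N\<in>Poly_Mapping.keys (h - Poly_Mapping.single M (Poly_Mapping.lookup f M)). weight N < weight M"
        by blast
    qed
  qed
  then have ker: "?I = ?K" using I_sub by blast
  \<comment> \<open>The minors of \<open>Xj j\<close> lie in the same corner regions, so the same
    homomorphism kills them; the contraction is squeezed between \<open>?I\<close> and
    \<open>?K\<close>.\<close>
  have "mixed_det_ideal k t Xj \<inter> polys L \<subseteq> ?K"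
    using mixed_det_ideal_subset_kernel[OF \<phi>.comm_ring_hom_axioms t, of Xj] minors_vanish Xj by blast
  moreover have "?I \<subseteq> mixed_det_ideal k t Xj"
  proof -
    have "det_ideal L (t j) (Lj j) \<subseteq> (det_ideal (\<Union>i\<in>{1..k}. Xj i) (t j) (Xj j) :: 'k mpoly set)"
      if "j \<in> {1..k}" for j
      using that t Lj_Xj unfolding L[symmetric] by (intro det_ideal_mono) auto
    then show ?thesis unfolding mixed_det_ideal_def L by blast
  qed
  moreover have "?I \<subseteq> polys L" using ker by blast
  ultimately have "mixed_det_ideal k t Xj \<inter> polys L = ?I" using ker by blast
  then show ?thesis using primeideal_kernel[OF \<phi>.comm_ring_hom_axioms, of L] ker by simp
qed

end
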